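(* Let $\mathcal{G}=(\Gamma,G)$ be a locally finite nonsingular graph of countable groups with $\Gamma^1\neq\emptyset$, and let $v\in\Gamma^0$. The action of $\pi_1(\mathcal{G},v)$ on $v\partial X_{\mathcal{G}}$ is minimal if and only if $\xi$ can flow to $e$ for every $\xi\in\partial W_{\mathcal{G}}$ and every $e\in\Gamma^1$.
   Context: Graphs. A graph $\Gamma=(\Gamma^0,\Gamma^1,r,s)$ consists of countable sets $\Gamma^0$ (vertices) and $\Gamma^1$ (edges), maps $r,s:\Gamma^1\to\Gamma^0$ (range, source), and a map $e\mapsto\overline e$ on $\Gamma^1$ with $\overline e\neq e$, $\overline{\overline e}=e$, $s(e)=r(\overline e)$. Graphs of groups. A graph of groups $\mathcal{G}=(\Gamma,G)$ consists of a connected graph $\Gamma$, groups $G_x$ ($x\in\Gamma^0$) and $G_e=G_{\overline e}$ ($e\in\Gamma^1$), and monomorphisms $\alpha_e:G_e\to G_{r(e)}$. It is locally finite if $|r^{-1}(x)|<\infty$ for all $x$ and $[G_{r(e)}:\alpha_e(G_e)]<\infty$ for all $e$; nonsingular if $[G_{r(e)}:\alpha_e(G_e)]>1$ whenever $r^{-1}(r(e))=\{e\}$; a graph of countable groups if every $G_x$ is countable. For each $e$ fix a transversal $\Sigma_e\ni 1$ for $G_{r(e)}/\alpha_e(G_e)$. Words. A $\mathcal{G}$-word is a sequence $g_1$, or $g_1e_1\cdots g_ne_n$, or $g_1e_1\cdots g_ne_ng_{n+1}$ with $s(e_i)=r(e_{i+1})$, $g_j\in G_{r(e_j)}$, $g_{n+1}\in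 G_{s(e_n)}$ (and $g_1$ in some vertex group if $n=0$); its range is $r(e_1)$, its source $s(e_n)$, its length $n$. It is reduced if (for $n>0$) $g_j\in\Sigma_{e_j}$ for $1\le j\le n$ and $g_{i+1}\ne1$ whenever $e_i=\overline{e_{i+1}}$ ($g_{n+1}$ arbitrary). A $\mathcal{G}$-path is a reduced $\mathcal{G}$-word $1_x$ or $g_1e_1\cdots g_ne_n$. The fundamental groupoid $F(\mathcal{G})$ consists of $\mathcal{G}$-words modulo the relations of the vertex groups and the relations $e\overline e=1_{r(e)}$, $e\,\alpha_{\overline e}(g)=\alpha_e(g)\,e$ ($g\in G_e$), under concatenation; each class contains a unique reduced $\mathcal{G}$-word. $\pi_1(\mathcal{G},v)$ is the group of its elements with range and source $v$. Boundary. An infinite reduced $\mathcal{G}$-path is a sequence $g_1e_1g_2e_2\cdots$ all of whose initial segments $g_1e_1\cdots g_ne_n$ are $\mathcal{G}$-paths; its range is $r(e_1)$. For $x\in\Gamma^0$, $x\partial W_{\mathcal{G}}$ is the set of those with range $x$; $\partial W_{\mathcal{G}}=\bigsqcup_x x\partial W_{\mathcal{G}}$; and $v\partial X_{\mathcal{G}}=v\partial W_{\mathcal{G}}$ (the boundary of the Bass--Serre tree). For a $\mathcal{G}$-path $\mu$, $Z(\mu)$ is the set of infinite reduced $\mathcal{G}$-paths extending $\mu$; these sets are a base for the topology. $\pi_1(\mathcal{G},v)$ acts on $v\partial X_{\mathcal{G}}$ by concatenation followed by reduction. An action of a discrete group on a locally compact Hausdorff space is minimal if every orbit is dense. Flowing.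 Let $e,f\in\Gamma^1$. $f$ lies on $\xi=h_1f_1h_2f_2\cdots\in\partial W_{\mathcal{G}}$ if $f=f_i$ for some $i$. $f$ can flow to $e$ if there is $\xi=h_1f_1h_2f_2\cdots\in Z(1e)$ (so $h_1f_1=1e$) with $f=f_i$ for some $i\ge2$. $\xi\in\partial W_{\mathcal{G}}$ can flow to $e$ if some edge $f$ lying on $\xi$ can flow to $e$. *)

theory Defs
  imports
    "HOL-Analysis.Abstract_Topology"
    "HOL-Library.Countable_Set"
    "HOL-Algebra.Left_Coset"
    "HOL-Algebra.Group_Action"
begin

section \<open>Graphs and graphs of groups\<close>

record ('v, 'e) graph =
  verts :: "'v set"
  edges :: "'e set"
  rng :: "'e \<Rightarrow> 'v"
  src :: "'e \<Rightarrow> 'v"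
  opp :: "'e \<Rightarrow> 'e"

locale graph =
  fixes \<Gamma> :: "('v, 'e, 'z) graph_scheme"
  assumes countable_verts: "countable (verts \<Gamma>)"
    and countable_edges: "countable (edges \<Gamma>)"
    and rng_in: "e \<in> edges \<Gamma> \<Longrightarrow> rng \<Gamma> e \<in> verts \<Gamma>"
    and src_in: "e \<in> edges \<Gamma> \<Longrightarrow> src \<Gamma> e \<in> verts \<Gamma>"
    and opp_in: "e \<in> edges \<Gamma> \<Longrightarrow> opp \<Gamma> e \<in> edges \<Gamma>"
    and opp_neq: "e \<in> edges \<Gamma> \<Longrightarrow> opp \<Gamma> e \<noteq> e"
    and opp_opp: "e \<in> edges \<Gamma> \<Longrightarrow> opp \<Gamma> (opp \<Gamma> e) = e"
    and src_eq: "e \<in> edges \<Gamma> \<Longrightarrow> src \<Gamma> e = rng \<Gamma> (opp \<Gamma> e)"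

definition connected_graph :: "('v, 'e, 'z) graph_scheme \<Rightarrow> bool" where
  "connected_graph \<Gamma> \<longleftrightarrow>
     (\<forall>x\<in>verts \<Gamma>. \<forall>y\<in>verts \<Gamma>. (x, y) \<in> {(rng \<Gamma> e, src \<Gamma> e) | e. e \<in> edges \<Gamma>}\<^sup>*)"

text \<open>
  All vertex groups live on one carrier type \<^typ>\<open>'g\<close> and all edge groups on one carrier type
  \<^typ>\<open>'h\<close>; distinct vertex groups may overlap as sets, and nothing depends on whether they do.
\<close>

record ('v, 'e, 'g, 'h) graph_of_groups = "('v, 'e) graph" +
  vgrp :: "'v \<Rightarrow> 'g monoid"
  egrp :: "'e \<Rightarrow> 'h monoid"
  emb :: "'e \<Rightarrow> 'h \<Rightarrow> 'g"

locale graph_of_groups = graph \<G>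
  for \<G> :: "('v, 'e, 'g, 'h) graph_of_groups" +
  assumes connected: "connected_graph \<G>"
    and group_vgrp: "x \<in> verts \<G> \<Longrightarrow> group (vgrp \<G> x)"
    and group_egrp: "e \<in> edges \<G> \<Longrightarrow> group (egrp \<G> e)"
    and egrp_opp: "e \<in> edges \<G> \<Longrightarrow> egrp \<G> (opp \<G> e) = egrp \<G> e"
    and emb_mon: "e \<in> edges \<G> \<Longrightarrow> emb \<G> e \<in> mon (egrp \<G> e) (vgrp \<G> (rng \<G> e))"

definition edge_subgroup :: "('v, 'e, 'g, 'h) graph_of_groups \<Rightarrow> 'e \<Rightarrow> 'g set" where
  "edge_subgroup \<G> e = emb \<G> e ` carrier (egrp \<G> e)"

definition edge_cosets :: "('v, 'e, 'g, 'h) graph_of_groups \<Rightarrow> 'e \<Rightarrow> 'g set set" where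
  "edge_cosets \<G> e = lcosets\<^bsub>vgrp \<G> (rng \<G> e)\<^esub> (edge_subgroup \<G> e)"

definition locally_finite :: "('v, 'e, 'g, 'h) graph_of_groups \<Rightarrow> bool" where
  "locally_finite \<G> \<longleftrightarrow>
     (\<forall>x\<in>verts \<G>. finite {e \<in> edges \<G>. rng \<G> e = x}) \<and>
     (\<forall>e\<in>edges \<G>. finite (edge_cosets \<G> e))"

text \<open>The disjunct for infinite index is needed because \<^const>\<open>card\<close> is \<open>0\<close> on infinite sets.\<close>

definition nonsingular :: "('v, 'e, 'g, 'h) graph_of_groups \<Rightarrow> bool" where
  "nonsingular \<G> \<longleftrightarrow>
     (\<forall>e\<in>edges \<G>. {f \<in> edges \<G>. rng \<G> f = rng \<G> e} = {e} \<longrightarrow>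
        infinite (edge_cosets \<G> e) \<or> card (edge_cosets \<G> e) > 1)"

definition countable_groups :: "('v, 'e, 'g, 'h) graph_of_groups \<Rightarrow> bool" where
  "countable_groups \<G> \<longleftrightarrow> (\<forall>x\<in>verts \<G>. countable (carrier (vgrp \<G> x)))"

definition transversals ::
  "('v, 'e, 'g, 'h) graph_of_groups \<Rightarrow> ('e \<Rightarrow> 'g set) \<Rightarrow> bool" where
  "transversals \<G> \<Sigma> \<longleftrightarrow>
     (\<forall>e\<in>edges \<G>. \<Sigma> e \<subseteq> carrier (vgrp \<G> (rng \<G> e)) \<and> \<one>\<^bsub>vgrp \<G> (rng \<G> e)\<^esub> \<in> \<Sigma> e \<and>
        (\<forall>C\<in>edge_cosets \<G> e. \<exists>!s. s \<in> \<Sigma> e \<and> s \<in> C))"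

section \<open>Words\<close>

text \<open>
  \<open>Word x [(g\<^sub>1, e\<^sub>1), \<dots>, (g\<^sub>n, e\<^sub>n)] h\<close> is the word \<open>g\<^sub>1 e\<^sub>1 \<dots> g\<^sub>n e\<^sub>n h\<close> with range \<open>x\<close>. A word
  \<open>g\<^sub>1 e\<^sub>1 \<dots> g\<^sub>n e\<^sub>n\<close> without final group element is identified with \<open>g\<^sub>1 e\<^sub>1 \<dots> g\<^sub>n e\<^sub>n 1\<close>, as it has to be
  for every class of the fundamental groupoid to contain only one reduced word. The range is recorded
  because it cannot be recovered from a word of length \<open>0\<close>.
\<close>

datatype ('v, 'e, 'g) word =
  Word (word_rng: 'v) (body: "('g \<times> 'e) list") (final: 'g)

definition word_src :: "('v, 'e, 'g, 'h) graph_of_groups \<Rightarrow> ('v, 'e, 'g) word \<Rightarrow> 'v" where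
  "word_src \<G> w = (if body w = [] then word_rng w else src \<G> (snd (last (body w))))"

fun word_from ::
  "('v, 'e, 'g, 'h) graph_of_groups \<Rightarrow> 'v \<Rightarrow> ('g \<times> 'e) list \<Rightarrow> 'g \<Rightarrow> bool" where
  "word_from \<G> x [] h \<longleftrightarrow> x \<in> verts \<G> \<and> h \<in> carrier (vgrp \<G> x)"
| "word_from \<G> x ((g, e) # u) h \<longleftrightarrow>
     e \<in> edges \<G> \<and> rng \<G> e = x \<and> g \<in> carrier (vgrp \<G> x) \<and> word_from \<G> (src \<G> e) u h"

definition is_word :: "('v, 'e, 'g, 'h) graph_of_groups \<Rightarrow> ('v, 'e, 'g) word \<Rightarrow> bool" where
  "is_word \<G> w \<longleftrightarrow> word_from \<G> (word_rng w) (body w) (final w)"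

definition reduced_word ::
  "('v, 'e, 'g, 'h) graph_of_groups \<Rightarrow> ('e \<Rightarrow> 'g set) \<Rightarrow> ('v, 'e, 'g) word \<Rightarrow> bool" where
  "reduced_word \<G> \<Sigma> w \<longleftrightarrow> is_word \<G> w \<and>
     (\<forall>(g, e)\<in>set (body w). g \<in> \<Sigma> e) \<and>
     (\<forall>i. Suc i < length (body w) \<longrightarrow>
        snd (body w ! i) = opp \<G> (snd (body w ! Suc i)) \<longrightarrow>
        fst (body w ! Suc i) \<noteq> \<one>\<^bsub>vgrp \<G> (rng \<G> (snd (body w ! Suc i)))\<^esub>)"

definition is_path ::
  "('v, 'e, 'g, 'h) graph_of_groups \<Rightarrow> ('e \<Rightarrow> 'g set) \<Rightarrow> ('v, 'e, 'g) word \<Rightarrow> bool" where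
  "is_path \<G> \<Sigma> w \<longleftrightarrow> reduced_word \<G> \<Sigma> w \<and> final w = \<one>\<^bsub>vgrp \<G> (word_src \<G> w)\<^esub>"

section \<open>The fundamental groupoid and the fundamental group\<close>

text \<open>
  Concatenation, for words with \<^term>\<open>word_src \<G> w = word_rng w'\<close>. The relations of the vertex
  groups are already built in: adjacent elements of the same vertex group are multiplied.
\<close>

fun cat ::
  "('v, 'e, 'g, 'h) graph_of_groups \<Rightarrow> ('v, 'e, 'g) word \<Rightarrow> ('v, 'e, 'g) word \<Rightarrow> ('v, 'e, 'g) word"
where
  "cat \<G> (Word x u h) (Word y [] k) = Word x u (h \<otimes>\<^bsub>vgrp \<G> y\<^esub> k)"
| "cat \<G> (Word x u h) (Word y ((g, e) # u') k) = Word x (u @ (h \<otimes>\<^bsub>vgrp \<G> y\<^esub> g, e) # u') k"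

inductive fg_eq ::
  "('v, 'e, 'g, 'h) graph_of_groups \<Rightarrow> ('v, 'e, 'g) word \<Rightarrow> ('v, 'e, 'g) word \<Rightarrow> bool"
  for \<G> where
  refl: "is_word \<G> w \<Longrightarrow> fg_eq \<G> w w"
| sym: "fg_eq \<G> w w' \<Longrightarrow> fg_eq \<G> w' w"
| trans: "fg_eq \<G> w w' \<Longrightarrow> fg_eq \<G> w' w'' \<Longrightarrow> fg_eq \<G> w w''"
| cong: "fg_eq \<G> w w' \<Longrightarrow> is_word \<G> p \<Longrightarrow> is_word \<G> q \<Longrightarrow>
    word_src \<G> p = word_rng w \<Longrightarrow> word_src \<G> w = word_rng q \<Longrightarrow>
    fg_eq \<G> (cat \<G> p (cat \<G> w q)) (cat \<G> p (cat \<G> w' q))"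
| cancel: "e \<in> edges \<G> \<Longrightarrow>
    fg_eq \<G>
      (Word (rng \<G> e)
         [(\<one>\<^bsub>vgrp \<G> (rng \<G> e)\<^esub>, e), (\<one>\<^bsub>vgrp \<G> (src \<G> e)\<^esub>, opp \<G> e)] \<one>\<^bsub>vgrp \<G> (rng \<G> e)\<^esub>)
      (Word (rng \<G> e) [] \<one>\<^bsub>vgrp \<G> (rng \<G> e)\<^esub>)"
| slide: "e \<in> edges \<G> \<Longrightarrow> g \<in> carrier (egrp \<G> e) \<Longrightarrow>
    fg_eq \<G>
      (Word (rng \<G> e) [(\<one>\<^bsub>vgrp \<G> (rng \<G> e)\<^esub>, e)] (emb \<G> (opp \<G> e) g))
      (Word (rng \<G> e) [(emb \<G> e g, e)] \<one>\<^bsub>vgrp \<G> (src \<G> e)\<^esub>)"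

definition fg_class ::
  "('v, 'e, 'g, 'h) graph_of_groups \<Rightarrow> ('v, 'e, 'g) word \<Rightarrow> ('v, 'e, 'g) word set" where
  "fg_class \<G> w = {w'. fg_eq \<G> w w'}"

definition fg_mult ::
  "('v, 'e, 'g, 'h) graph_of_groups \<Rightarrow>
   ('v, 'e, 'g) word set \<Rightarrow> ('v, 'e, 'g) word set \<Rightarrow> ('v, 'e, 'g) word set" where
  "fg_mult \<G> A B = (\<Union>a\<in>A. \<Union>b\<in>B. fg_class \<G> (cat \<G> a b))"

definition pi1 ::
  "('v, 'e, 'g, 'h) graph_of_groups \<Rightarrow> 'v \<Rightarrow> ('v, 'e, 'g) word set monoid" where
  "pi1 \<G> v =
     \<lparr>carrier = {fg_class \<G> w | w. is_word \<G> w \<and> word_rng w = v \<and> word_src \<G> w = v},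
      mult = fg_mult \<G>,
      one = fg_class \<G> (Word v [] \<one>\<^bsub>vgrp \<G> v\<^esub>)\<rparr>"

definition reduced_form ::
  "('v, 'e, 'g, 'h) graph_of_groups \<Rightarrow> ('e \<Rightarrow> 'g set) \<Rightarrow>
   ('v, 'e, 'g) word set \<Rightarrow> ('v, 'e, 'g) word" where
  "reduced_form \<G> \<Sigma> A = (THE w. w \<in> A \<and> reduced_word \<G> \<Sigma> w)"

section \<open>The boundary\<close>

text \<open>Indices start at \<open>0\<close>: the sequence \<open>h\<^sub>1 f\<^sub>1 h\<^sub>2 f\<^sub>2 \<dots>\<close> is \<open>\<lambda>i. (h\<^sub>i\<^sub>+\<^sub>1, f\<^sub>i\<^sub>+\<^sub>1)\<close>.\<close>

type_synonym ('e, 'g) infinite_word = "nat \<Rightarrow> 'g \<times> 'e"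

definition inf_rng ::
  "('v, 'e, 'g, 'h) graph_of_groups \<Rightarrow> ('e, 'g) infinite_word \<Rightarrow> 'v" where
  "inf_rng \<G> \<xi> = rng \<G> (snd (\<xi> 0))"

definition segment ::
  "('v, 'e, 'g, 'h) graph_of_groups \<Rightarrow> ('e, 'g) infinite_word \<Rightarrow> nat \<Rightarrow> ('v, 'e, 'g) word" where
  "segment \<G> \<xi> n = Word (inf_rng \<G> \<xi>) (map \<xi> [0..<n])
     \<one>\<^bsub>vgrp \<G> (if n = 0 then inf_rng \<G> \<xi> else src \<G> (snd (\<xi> (n - 1))))\<^esub>"

definition boundary ::
  "('v, 'e, 'g, 'h) graph_of_groups \<Rightarrow> ('e \<Rightarrow> 'g set) \<Rightarrow> ('e, 'g) infinite_word set" where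
  "boundary \<G> \<Sigma> = {\<xi>. \<forall>n. is_path \<G> \<Sigma> (segment \<G> \<xi> n)}"

definition cylinder ::
  "('v, 'e, 'g, 'h) graph_of_groups \<Rightarrow> ('e \<Rightarrow> 'g set) \<Rightarrow>
   ('v, 'e, 'g) word \<Rightarrow> ('e, 'g) infinite_word set" where
  "cylinder \<G> \<Sigma> \<mu> = {\<xi> \<in> boundary \<G> \<Sigma>. segment \<G> \<xi> (length (body \<mu>)) = \<mu>}"

text \<open>The space \<open>v\<partial>X\<close>; its underlying set is the cylinder of the trivial path at \<open>v\<close>.\<close>

definition boundary_at ::
  "('v, 'e, 'g, 'h) graph_of_groups \<Rightarrow> ('e \<Rightarrow> 'g set) \<Rightarrow> 'v \<Rightarrow> ('e, 'g) infinite_word topology" where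
  "boundary_at \<G> \<Sigma> v =
     topology_generated_by {cylinder \<G> \<Sigma> \<mu> | \<mu>. is_path \<G> \<Sigma> \<mu> \<and> word_rng \<mu> = v}"

text \<open>
  Concatenation followed by reduction: \<open>A \<cdot> \<xi>\<close> is the infinite path to which the reduced forms of
  \<open>A \<cdot> h\<^sub>1 f\<^sub>1 \<dots> h\<^sub>m f\<^sub>m\<close> converge as \<open>m\<close> grows. The group element at the end of these reduced forms is
  discarded, since it is absorbed by the next letter of \<open>\<xi>\<close>.
\<close>

definition boundary_act ::
  "('v, 'e, 'g, 'h) graph_of_groups \<Rightarrow> ('e \<Rightarrow> 'g set) \<Rightarrow>
   ('v, 'e, 'g) word set \<Rightarrow> ('e, 'g) infinite_word \<Rightarrow> ('e, 'g) infinite_word" where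
  "boundary_act \<G> \<Sigma> A \<xi> =
     (THE \<eta>. \<forall>n. \<forall>\<^sub>F m in sequentially.
        let u = body (reduced_form \<G> \<Sigma> (fg_mult \<G> A (fg_class \<G> (segment \<G> \<xi> m))))
        in n < length u \<and> u ! n = \<eta> n)"

definition minimal_action ::
  "('a, 'b) monoid_scheme \<Rightarrow> 'x topology \<Rightarrow> ('a \<Rightarrow> 'x \<Rightarrow> 'x) \<Rightarrow> bool" where
  "minimal_action G X \<phi> \<longleftrightarrow> (\<forall>x\<in>topspace X. X closure_of (orbit G \<phi> x) = topspace X)"

section \<open>Flowing\<close>

definition lies_on :: "'e \<Rightarrow> ('e, 'g) infinite_word \<Rightarrow> bool" where
  "lies_on f \<xi> \<longleftrightarrow> (\<exists>i. f = snd (\<xi> i))"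

definition edge_path :: "('v, 'e, 'g, 'h) graph_of_groups \<Rightarrow> 'e \<Rightarrow> ('v, 'e, 'g) word" where
  "edge_path \<G> e =
     Word (rng \<G> e) [(\<one>\<^bsub>vgrp \<G> (rng \<G> e)\<^esub>, e)] \<one>\<^bsub>vgrp \<G> (src \<G> e)\<^esub>"

definition edge_flows_to ::
  "('v, 'e, 'g, 'h) graph_of_groups \<Rightarrow> ('e \<Rightarrow> 'g set) \<Rightarrow> 'e \<Rightarrow> 'e \<Rightarrow> bool" where
  "edge_flows_to \<G> \<Sigma> f e \<longleftrightarrow>
     (\<exists>\<xi>\<in>cylinder \<G> \<Sigma> (edge_path \<G> e). \<exists>i\<ge>1. f = snd (\<xi> i))"

definition flows_to ::
  "('v, 'e, 'g, 'h) graph_of_groups \<Rightarrow> ('e \<Rightarrow> 'g set) \<Rightarrow> ('e, 'g) infinite_word \<Rightarrow> 'e \<Rightarrow> bool" where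
  "flows_to \<G> \<Sigma> \<xi> e \<longleftrightarrow> (\<exists>f. lies_on f \<xi> \<and> edge_flows_to \<G> \<Sigma> f e)"

end

theory Submission
  imports "HOL-Library.Omega_Words_Fun" Defs
begin

text \<open>
  The group acts on reduced words by van der Waerden's trick, which gives normal forms in the fundamental
  groupoid. Cancellation between a group element and an infinite path \<open>\<xi>\<close> ends after finitely many
  letters, and from then on group elements slide through the edges; hence \<open>\<gamma> \<cdot> \<xi>\<close> and \<open>\<xi>\<close> have, up to
  a shift, the same edges far out. Of the first of two adjacent letters only its edge matters for whether they cancel,
  so a reduced path may be cut at an edge and continued by the tail of any other reduced path behind
  the same edge. If the action is minimal, some translate of \<open>\<xi>\<close> enters a cylinder whose last edge can be
  reached from \<open>1e\<close>, and grafting its tail onto that path shows that \<open>\<xi>\<close> flows to \<open>e\<close>. Conversely,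
  if \<open>\<xi>\<close> flows to the last edge of a path \<open>\<mu>\<close>, then grafting a tail of \<open>\<xi>\<close> onto an extension of \<open>\<mu>\<close>
  gives a translate of \<open>\<xi>\<close> in \<open>Z(\<mu>)\<close>.
\<close>

hide_type (open) Omega_Words_Fun.word

locale transversal_graph_of_groups = graph_of_groups \<G>
  for \<G> :: "('v, 'e, 'g, 'h) graph_of_groups" +
  fixes \<Sigma> :: "'e \<Rightarrow> 'g set"
  assumes transversals: "transversals \<G> \<Sigma>"
begin

section \<open>Vertex groups, edge groups and coset representatives\<close>

abbreviation vmult :: "'g \<Rightarrow> 'v \<Rightarrow> 'g \<Rightarrow> 'g" ("_ \<cdot>\<^bsub>_\<^esub> _" [70, 0, 71] 70)
  where "a \<cdot>\<^bsub>x\<^esub> b \<equiv> a \<otimes>\<^bsub>vgrp \<G> x\<^esub> b"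

abbreviation vone :: "'v \<Rightarrow> 'g" ("1\<^bsub>_\<^esub>")
  where "1\<^bsub>x\<^esub> \<equiv> \<one>\<^bsub>vgrp \<G> x\<^esub>"

abbreviation vcarrier :: "'v \<Rightarrow> 'g set"
  where "vcarrier x \<equiv> carrier (vgrp \<G> x)"

abbreviation ecarrier :: "'e \<Rightarrow> 'h set"
  where "ecarrier e \<equiv> carrier (egrp \<G> e)"

declare rng_in [simp] src_in [simp] opp_in [simp] opp_opp [simp]

lemma rng_opp [simp]: "e \<in> edges \<G> \<Longrightarrow> rng \<G> (opp \<G> e) = src \<G> e"
  by (simp add: src_eq)

lemma src_opp [simp]: "e \<in> edges \<G> \<Longrightarrow> src \<G> (opp \<G> e) = rng \<G> e"
  by (simp add: src_eq)

lemma vmult_closed [simp]: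
  "x \<in> verts \<G> \<Longrightarrow> a \<in> vcarrier x \<Longrightarrow> b \<in> vcarrier x \<Longrightarrow> a \<cdot>\<^bsub>x\<^esub> b \<in> vcarrier x"
  by (simp add: group.is_monoid group_vgrp monoid.m_closed)

lemma vone_closed [simp]: "x \<in> verts \<G> \<Longrightarrow> 1\<^bsub>x\<^esub> \<in> vcarrier x"
  by (simp add: group.is_monoid group_vgrp monoid.one_closed)

lemma vmult_assoc:
  "x \<in> verts \<G> \<Longrightarrow> a \<in> vcarrier x \<Longrightarrow> b \<in> vcarrier x \<Longrightarrow> c \<in> vcarrier x
    \<Longrightarrow> a \<cdot>\<^bsub>x\<^esub> b \<cdot>\<^bsub>x\<^esub> c = a \<cdot>\<^bsub>x\<^esub> (b \<cdot>\<^bsub>x\<^esub> c)"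
  by (simp add: group.is_monoid group_vgrp monoid.m_assoc)

lemma vmult_one [simp]:
  "x \<in> verts \<G> \<Longrightarrow> a \<in> vcarrier x \<Longrightarrow> a \<cdot>\<^bsub>x\<^esub> 1\<^bsub>x\<^esub> = a"
  "x \<in> verts \<G> \<Longrightarrow> a \<in> vcarrier x \<Longrightarrow> 1\<^bsub>x\<^esub> \<cdot>\<^bsub>x\<^esub> a = a"
  by (simp_all add: group.is_monoid group_vgrp)

lemma egrp_opp_simps [simp]: "e \<in> edges \<G> \<Longrightarrow> egrp \<G> (opp \<G> e) = egrp \<G> e"
  by (rule egrp_opp)

lemma emb_group_hom:
  assumes "e \<in> edges \<G>"
  shows "group_hom (egrp \<G> e) (vgrp \<G> (rng \<G> e)) (emb \<G> e)"
  using assms emb_mon[OF assms] group_egrp group_vgrp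
  by (auto simp: group_hom_def group_hom_axioms_def mon_def)

lemma emb_inj: "e \<in> edges \<G> \<Longrightarrow> inj_on (emb \<G> e) (ecarrier e)"
  using emb_mon by (auto simp: mon_def)

lemma emb_closed [simp]:
  assumes "e \<in> edges \<G>" "k \<in> ecarrier e"
  shows "emb \<G> e k \<in> vcarrier (rng \<G> e)" "emb \<G> (opp \<G> e) k \<in> vcarrier (src \<G> e)"
  using group_hom.hom_closed[OF emb_group_hom] opp_in rng_opp egrp_opp assms by metis+

lemma emb_mult:
  assumes "e \<in> edges \<G>" "k \<in> ecarrier e" "l \<in> ecarrier e"
  shows "emb \<G> e (k \<otimes>\<^bsub>egrp \<G> e\<^esub> l) = emb \<G> e k \<cdot>\<^bsub>rng \<G> e\<^esub> emb \<G> e l"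
    and "emb \<G> (opp \<G> e) (k \<otimes>\<^bsub>egrp \<G> e\<^esub> l) = emb \<G> (opp \<G> e) k \<cdot>\<^bsub>src \<G> e\<^esub> emb \<G> (opp \<G> e) l"
  using group_hom.hom_mult[OF emb_group_hom] opp_in rng_opp egrp_opp assms by metis+

lemma emb_one [simp]:
  assumes "e \<in> edges \<G>"
  shows "emb \<G> e \<one>\<^bsub>egrp \<G> e\<^esub> = 1\<^bsub>rng \<G> e\<^esub>" "emb \<G> (opp \<G> e) \<one>\<^bsub>egrp \<G> e\<^esub> = 1\<^bsub>src \<G> e\<^esub>"
  using group_hom.hom_one[OF emb_group_hom] opp_in rng_opp egrp_opp assms by metis+

lemma egrp_closed [simp]:
  "e \<in> edges \<G> \<Longrightarrow> \<one>\<^bsub>egrp \<G> e\<^esub> \<in> ecarrier e"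
  "e \<in> edges \<G> \<Longrightarrow> k \<in> ecarrier e \<Longrightarrow> l \<in> ecarrier e \<Longrightarrow> k \<otimes>\<^bsub>egrp \<G> e\<^esub> l \<in> ecarrier e"
  by (simp_all add: group.is_monoid group_egrp monoid.m_closed)

lemma edge_subgroup: "e \<in> edges \<G> \<Longrightarrow> subgroup (edge_subgroup \<G> e) (vgrp \<G> (rng \<G> e))"
  unfolding edge_subgroup_def by (rule group_hom.img_is_subgroup[OF emb_group_hom])

lemma transversal_closed [simp]: "e \<in> edges \<G> \<Longrightarrow> s \<in> \<Sigma> e \<Longrightarrow> s \<in> vcarrier (rng \<G> e)"
  using transversals by (auto simp: transversals_def)

lemma one_in_transversal [simp]: "e \<in> edges \<G> \<Longrightarrow> 1\<^bsub>rng \<G> e\<^esub> \<in> \<Sigma> e"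
  using transversals by (auto simp: transversals_def)

lemma l_coset_edge_subgroup:
  "a <#\<^bsub>vgrp \<G> x\<^esub> edge_subgroup \<G> e = {a \<cdot>\<^bsub>x\<^esub> emb \<G> e k | k. k \<in> ecarrier e}"
  by (auto simp: l_coset_def edge_subgroup_def)

text \<open>Left cosets of the edge subgroup partition the vertex group, so the coset of
  \<open>a\<close> determines \<open>s\<close>; cancelling \<open>s\<close> and injectivity of
  \<open>emb\<close> then determine \<open>k\<close>.\<close>

lemma transversal_decomposition:
  assumes e: "e \<in> edges \<G>" and a: "a \<in> vcarrier (rng \<G> e)"
  shows "\<exists>!(s, k). s \<in> \<Sigma> e \<and> k \<in> ecarrier e \<and> a = s \<cdot>\<^bsub>rng \<G> e\<^esub> emb \<G> e k"
proof -
  let ?x = "rng \<G> e" let ?H = "edge_subgroup \<G> e"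
  interpret group "vgrp \<G> ?x" using e group_vgrp by simp
  interpret H: subgroup ?H "vgrp \<G> ?x" using e by (rule edge_subgroup)
  have coset: "a <#\<^bsub>vgrp \<G> ?x\<^esub> ?H \<in> edge_cosets \<G> e"
    using a by (auto simp: edge_cosets_def LCOSETS_def)
  then obtain s where s: "s \<in> \<Sigma> e" "s \<in> a <#\<^bsub>vgrp \<G> ?x\<^esub> ?H"
    and uniq: "\<And>t. t \<in> \<Sigma> e \<Longrightarrow> t \<in> a <#\<^bsub>vgrp \<G> ?x\<^esub> ?H \<Longrightarrow> t = s"
    using transversals e unfolding transversals_def by metis
  \<comment> \<open>\<open>transversals\<close> puts the representative into the coset of
    \<open>a\<close>, while the factorization needs \<open>a\<close> in the coset of the
    representative.\<close>
  have swap: "t \<in> a <#\<^bsub>vgrp \<G> ?x\<^esub> ?H \<longleftrightarrow> a \<in> t <#\<^bsub>vgrp \<G> ?x\<^esub> ?H"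
    if "t \<in> vcarrier ?x" for t
    using that a l_repr_independence[OF _ _ H.subgroup_axioms] lcos_self[OF _ H.subgroup_axioms]
    by metis
  obtain k where k: "k \<in> ecarrier e" "a = s \<cdot>\<^bsub>?x\<^esub> emb \<G> e k"
    using s swap[of s] e by (auto simp: l_coset_edge_subgroup)
  show ?thesis
  proof (intro ex1I[of _ "(s, k)"]; clarify)
    show "s \<in> \<Sigma> e \<and> k \<in> ecarrier e \<and> a = s \<cdot>\<^bsub>?x\<^esub> emb \<G> e k" using s k by simp
    fix t l assume *: "t \<in> \<Sigma> e" "l \<in> ecarrier e" "a = t \<cdot>\<^bsub>?x\<^esub> emb \<G> e l"
    then have "t = s" using swap[of t] uniq[of t] e by (auto simp: l_coset_edge_subgroup)
    moreover from this have "emb \<G> e l = emb \<G> e k" using * k s e by simp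
    then have "l = k" using emb_inj[OF e] * k by (simp add: inj_on_eq_iff)
    ultimately show "t = s \<and> l = k" by simp
  qed
qed

text \<open>The first component is the group element that stays in front of the edge
  \<open>e\<close> in a normal form; the second is slid through \<open>e\<close>.\<close>

definition decompose :: "'e \<Rightarrow> 'g \<Rightarrow> 'g \<times> 'h" where
  "decompose e a = (THE (s, k). s \<in> \<Sigma> e \<and> k \<in> ecarrier e \<and> a = s \<cdot>\<^bsub>rng \<G> e\<^esub> emb \<G> e k)"

lemma decompose_eqI:
  assumes "e \<in> edges \<G>" "s \<in> \<Sigma> e" "k \<in> ecarrier e" "a = s \<cdot>\<^bsub>rng \<G> e\<^esub> emb \<G> e k"
  shows "decompose e a = (s, k)"
  unfolding decompose_def
  by (rule the1_equality[OF transversal_decomposition]) (use assms in auto)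

lemma decomposeE:
  assumes "e \<in> edges \<G>" "a \<in> vcarrier (rng \<G> e)"
  obtains s k where "s \<in> \<Sigma> e" "k \<in> ecarrier e" "a = s \<cdot>\<^bsub>rng \<G> e\<^esub> emb \<G> e k"
    "decompose e a = (s, k)"
  using transversal_decomposition[OF assms] decompose_eqI[OF assms(1)] by auto

subsection \<open>Words and the fundamental groupoid\<close>

text \<open>Naming the end vertex, which \<open>word_from\<close> leaves implicit, makes lists of
  letters composable like arrows of a category.\<close>

fun walk :: "'v \<Rightarrow> ('g \<times> 'e) list \<Rightarrow> 'v \<Rightarrow> bool" where
  "walk x [] y \<longleftrightarrow> x = y \<and> x \<in> verts \<G>"
| "walk x (p # u) y \<longleftrightarrow> snd p \<in> edges \<G> \<and> rng \<G> (snd p) = x \<and> fst p \<in> vcarrier x \<and>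
     walk (src \<G> (snd p)) u y"

lemma walk_append: "walk x (u @ u') y \<longleftrightarrow> (\<exists>z. walk x u z \<and> walk z u' y)"
  by (induction u arbitrary: x) (auto elim: walk.elims)

lemma walk_verts: "walk x u y \<Longrightarrow> x \<in> verts \<G> \<and> y \<in> verts \<G>"
  by (induction u arbitrary: x) auto

lemma walk_snoc [simp]:
  "walk x (u @ [p]) y \<longleftrightarrow>
    snd p \<in> edges \<G> \<and> src \<G> (snd p) = y \<and> fst p \<in> vcarrier (rng \<G> (snd p)) \<and> walk x u (rng \<G> (snd p))"
  by (auto simp: walk_append dest: walk_verts)

lemma walk_src: "walk x u y \<Longrightarrow> (if u = [] then x else src \<G> (snd (last u))) = y"
  by (induction u arbitrary: x) auto

lemma word_from_iff: "word_from \<G> x u h \<longleftrightarrow> (\<exists>y. walk x u y \<and> h \<in> vcarrier y)"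
  by (induction u arbitrary: x) auto

definition word_between :: "'v \<Rightarrow> ('v, 'e, 'g) Defs.word \<Rightarrow> 'v \<Rightarrow> bool" where
  "word_between x w y \<longleftrightarrow> is_word \<G> w \<and> word_rng w = x \<and> word_src \<G> w = y"

lemma word_between_Word [simp]:
  "word_between x (Word x' u h) y \<longleftrightarrow> x' = x \<and> walk x u y \<and> h \<in> vcarrier y"
proof -
  have "walk x u y' \<Longrightarrow> (if u = [] then x else src \<G> (snd (last u))) = y \<longleftrightarrow> y' = y" for y'
    using walk_src by blast
  then show ?thesis
    by (auto simp: word_between_def is_word_def word_from_iff word_src_def simp del: if_split)
qed

lemma word_betweenE:
  assumes "word_between x w y"
  obtains u h where "w = Word x u h" "walk x u y" "h \<in> vcarrier y"
  using assms by (cases w) auto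

lemma word_between_unique:
  "word_between x w y \<Longrightarrow> word_between x' w y' \<Longrightarrow> x' = x \<and> y' = y"
  by (simp add: word_between_def)

lemma word_between_verts: "word_between x w y \<Longrightarrow> x \<in> verts \<G> \<and> y \<in> verts \<G>"
  by (auto elim!: word_betweenE dest: walk_verts)

lemma is_word_iff: "is_word \<G> w \<longleftrightarrow> word_between (word_rng w) w (word_src \<G> w)"
  by (simp add: word_between_def)

lemma cat_Word:
  "cat \<G> (Word x u h) (Word y u' k) =
    (case u' of [] \<Rightarrow> Word x u (h \<cdot>\<^bsub>y\<^esub> k) | p # u'' \<Rightarrow> Word x (u @ (h \<cdot>\<^bsub>y\<^esub> fst p, snd p) # u'') k)"
  by (cases u') auto

lemma word_between_cat:
  "word_between x p y \<Longrightarrow> word_between y q z \<Longrightarrow> word_between x (cat \<G> p q) z"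
  by (fastforce elim!: word_betweenE dest: walk_verts simp: cat_Word walk_append split: list.splits)

lemma cat_assoc:
  assumes "word_between w p x" "word_between x q y" "word_between y r z"
  shows "cat \<G> (cat \<G> p q) r = cat \<G> p (cat \<G> q r)"
  using assms by (fastforce elim!: word_betweenE dest: walk_verts
      simp: cat_Word vmult_assoc split: list.splits)

lemma cat_unit:
  "word_between x p y \<Longrightarrow> cat \<G> p (Word y [] 1\<^bsub>y\<^esub>) = p"
  "word_between x p y \<Longrightarrow> cat \<G> (Word x [] 1\<^bsub>x\<^esub>) p = p"
  by (fastforce elim!: word_betweenE dest: walk_verts simp: cat_Word split: list.splits)+

lemma fg_eq_word_between:
  "fg_eq \<G> w w' \<Longrightarrow> \<exists>x y. word_between x w y \<and> word_between x w' y"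
proof (induction rule: fg_eq.induct)
  case (trans w w' w'')
  then show ?case using word_between_unique by metis
next
  case (cong w w' p q)
  then obtain x y where w: "word_between x w y" "word_between x w' y" by blast
  then have "word_between (word_rng p) p x" "word_between y q (word_src \<G> q)"
    using cong by (simp_all add: word_between_def)
  then show ?case using w word_between_cat by metis
next
  case (cancel e)
  then show ?case by (intro exI[of _ "rng \<G> e"]) simp
next
  case (slide e g)
  then show ?case by (intro exI[of _ "rng \<G> e"] exI[of _ "src \<G> e"]) simp
qed (auto simp: is_word_iff)

lemma fg_eq_transfer: "fg_eq \<G> w w' \<Longrightarrow> word_between x w y \<Longrightarrow> word_between x w' y"
  using fg_eq_word_between word_between_unique by metis

lemma fg_eq_refl: "word_between x w y \<Longrightarrow> fg_eq \<G> w w"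
  by (rule fg_eq.refl) (simp add: word_between_def)

lemma fg_eq_cong:
  assumes "fg_eq \<G> w w'" "word_between x p x'" "word_between x' w y'" "word_between y' q y"
  shows "fg_eq \<G> (cat \<G> p (cat \<G> w q)) (cat \<G> p (cat \<G> w' q))"
  using assms by (auto simp: word_between_def intro: fg_eq.cong)

lemma fg_eq_cat_right:
  assumes "fg_eq \<G> p p'" "word_between x p y" "word_between y q z"
  shows "fg_eq \<G> (cat \<G> p q) (cat \<G> p' q)"
proof -
  have "word_between x (cat \<G> p q) z" "word_between x (cat \<G> p' q) z"
    using assms fg_eq_transfer word_between_cat by blast+
  moreover have "word_between x (Word x [] 1\<^bsub>x\<^esub>) x"
    using assms word_between_verts by simp
  ultimately show ?thesis
    using fg_eq_cong[OF assms(1) _ assms(2,3), of x "Word x [] 1\<^bsub>x\<^esub>"] cat_unit(2) by metis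
qed

lemma fg_eq_cat_left:
  assumes "fg_eq \<G> q q'" "word_between x p y" "word_between y q z"
  shows "fg_eq \<G> (cat \<G> p q) (cat \<G> p q')"
proof -
  have "word_between z (Word z [] 1\<^bsub>z\<^esub>) z" "word_between y q' z"
    using assms word_between_verts fg_eq_transfer by (simp, blast)
  then show ?thesis
    using fg_eq_cong[OF assms, of "Word z [] 1\<^bsub>z\<^esub>" z] assms(3) cat_unit(1) by metis
qed

lemma fg_eq_cat:
  assumes "fg_eq \<G> p p'" "fg_eq \<G> q q'" "word_between x p y" "word_between y q z"
  shows "fg_eq \<G> (cat \<G> p q) (cat \<G> p' q')"
  using assms fg_eq_cat_left fg_eq_cat_right fg_eq_transfer fg_eq.trans by metis

lemma fg_class_eq_iff: "word_between x w y \<Longrightarrow> fg_class \<G> w = fg_class \<G> w' \<longleftrightarrow> fg_eq \<G> w w'"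
  unfolding fg_class_def using fg_eq_refl fg_eq.sym fg_eq.trans by blast

text \<open>\<open>fg_mult\<close> is a union over all pairs of representatives. Concatenation
  respects classes, so all members of the union coincide, and the union is not over an empty family
  because a class contains its representative.\<close>

lemma fg_mult_class:
  assumes "word_between x p y" "word_between y q z"
  shows "fg_mult \<G> (fg_class \<G> p) (fg_class \<G> q) = fg_class \<G> (cat \<G> p q)"
proof -
  have eq: "fg_class \<G> (cat \<G> p' q') = fg_class \<G> (cat \<G> p q)"
    if "p' \<in> fg_class \<G> p" "q' \<in> fg_class \<G> q" for p' q'
  proof -
    have "fg_eq \<G> (cat \<G> p q) (cat \<G> p' q')"
      using that fg_eq_cat[OF _ _ assms] by (simp add: fg_class_def)
    then show ?thesis by (rule fg_class_eq_iff[OF word_between_cat[OF assms], THEN iffD2, symmetric])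
  qed
  have "fg_mult \<G> (fg_class \<G> p) (fg_class \<G> q) =
      (\<Union>p'\<in>fg_class \<G> p. \<Union>q'\<in>fg_class \<G> q. fg_class \<G> (cat \<G> p q))"
    unfolding fg_mult_def by (intro SUP_cong HOL.refl) (rule eq)
  moreover have "p \<in> fg_class \<G> p" "q \<in> fg_class \<G> q"
    using assms fg_eq_refl by (simp_all add: fg_class_def)
  ultimately show ?thesis by auto
qed

lemma fg_eq_cancel:
  assumes "walk x u (rng \<G> e)" "e \<in> edges \<G>" "h \<in> vcarrier (rng \<G> e)" "k \<in> vcarrier (rng \<G> e)"
  shows "fg_eq \<G> (Word x (u @ [(h, e), (1\<^bsub>src \<G> e\<^esub>, opp \<G> e)]) k) (Word x u (h \<cdot>\<^bsub>rng \<G> e\<^esub> k))"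
  using fg_eq_cong[OF fg_eq.cancel[OF assms(2)], where x = x and p = "Word x u h"
      and q = "Word (rng \<G> e) [] k" and x' = "rng \<G> e" and y' = "rng \<G> e" and y = "rng \<G> e"] assms
  by simp

lemma fg_eq_slide:
  assumes "walk x u (rng \<G> e)" "e \<in> edges \<G>" "h \<in> vcarrier (rng \<G> e)" "g \<in> ecarrier e"
  shows "fg_eq \<G> (Word x (u @ [(h \<cdot>\<^bsub>rng \<G> e\<^esub> emb \<G> e g, e)]) 1\<^bsub>src \<G> e\<^esub>)
    (Word x (u @ [(h, e)]) (emb \<G> (opp \<G> e) g))"
  using fg_eq.sym[OF fg_eq_cong[OF fg_eq.slide[OF assms(2,4)], where x = x and p = "Word x u h"
      and q = "Word (src \<G> e) [] 1\<^bsub>src \<G> e\<^esub>" and x' = "rng \<G> e" and y' = "src \<G> e" and y = "src \<G> e"]] assms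
  by simp

text \<open>The inverse of \<open>u g e h\<close> is the inverse of \<open>h\<close>, then the
  reversed edge, then the inverse of \<open>u g\<close>; hence the induction from the right end.
  Later it supplies the group element that exchanges one initial segment of an infinite path for
  another.\<close>

lemma ex_inverse_word:
  assumes "word_between x w y"
  shows "\<exists>w'. word_between y w' x \<and> fg_eq \<G> (cat \<G> w' w) (Word y [] 1\<^bsub>y\<^esub>)"
proof -
  obtain u h where w: "w = Word x u h" and "walk x u y" "h \<in> vcarrier y"
    using assms by (rule word_betweenE)
  then show ?thesis unfolding w
  proof (induction u arbitrary: y h rule: rev_induct)
    case Nil
    then interpret group "vgrp \<G> y" by (auto intro: group_vgrp)
    show ?case using Nil
      by (intro exI[of _ "Word y [] (inv\<^bsub>vgrp \<G> y\<^esub> h)"]) (auto intro!: fg_eq_refl)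
  next
    case (snoc p u)
    obtain g e where p: "p = (g, e)" by fastforce
    with snoc.prems have e: "e \<in> edges \<G>" "src \<G> e = y" "g \<in> vcarrier (rng \<G> e)"
      "walk x u (rng \<G> e)" "h \<in> vcarrier y" by auto
    interpret group "vgrp \<G> y" using e group_vgrp by auto
    obtain w' where w': "word_between (rng \<G> e) w' x"
      "fg_eq \<G> (cat \<G> w' (Word x u g)) (Word (rng \<G> e) [] 1\<^bsub>rng \<G> e\<^esub>)"
      using snoc.IH[where y = "rng \<G> e" and h = g] e by auto
    let ?i = "Word y [(inv\<^bsub>vgrp \<G> y\<^esub> h, opp \<G> e)] 1\<^bsub>rng \<G> e\<^esub>"
    let ?f = "Word (rng \<G> e) [(1\<^bsub>rng \<G> e\<^esub>, e)] h"
    have i: "word_between y ?i (rng \<G> e)" and f: "word_between (rng \<G> e) ?f y"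
      and u: "word_between x (Word x u g) (rng \<G> e)"
      using e by auto
    have w: "Word x (u @ [p]) h = cat \<G> (Word x u g) ?f" using e p by simp
    have 1: "cat \<G> (cat \<G> ?i w') (Word x (u @ [p]) h) = cat \<G> ?i (cat \<G> (cat \<G> w' (Word x u g)) ?f)"
      unfolding w using cat_assoc[OF i w'(1) word_between_cat[OF u f]] cat_assoc[OF w'(1) u f]
      by (simp only:)
    have 2: "fg_eq \<G> (cat \<G> ?i (cat \<G> (cat \<G> w' (Word x u g)) ?f))
        (cat \<G> ?i (cat \<G> (Word (rng \<G> e) [] 1\<^bsub>rng \<G> e\<^esub>) ?f))"
      using fg_eq_cong[OF w'(2) i word_between_cat[OF w'(1) u] f] .
    have 3: "cat \<G> ?i (cat \<G> (Word (rng \<G> e) [] 1\<^bsub>rng \<G> e\<^esub>) ?f)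
        = Word y [(inv\<^bsub>vgrp \<G> y\<^esub> h, opp \<G> e), (1\<^bsub>rng \<G> e\<^esub>, e)] h"
      using e by simp
    have 4: "fg_eq \<G> (Word y [(inv\<^bsub>vgrp \<G> y\<^esub> h, opp \<G> e), (1\<^bsub>rng \<G> e\<^esub>, e)] h) (Word y [] 1\<^bsub>y\<^esub>)"
      using fg_eq_cancel[of y "[]" "opp \<G> e" "inv\<^bsub>vgrp \<G> y\<^esub> h" h] e by auto
    have "fg_eq \<G> (cat \<G> (cat \<G> ?i w') (Word x (u @ [p]) h)) (Word y [] 1\<^bsub>y\<^esub>)"
      unfolding 1 using 2 4 unfolding 3 by (rule fg_eq.trans)
    then show ?case using word_between_cat[OF i w'(1)] by blast
  qed
qed

subsection \<open>Reduced words and normal forms\<close>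

definition no_backtrack :: "'g \<times> 'e \<Rightarrow> 'g \<times> 'e \<Rightarrow> bool" where
  "no_backtrack p q \<longleftrightarrow> (snd p = opp \<G> (snd q) \<longrightarrow> fst q \<noteq> 1\<^bsub>rng \<G> (snd q)\<^esub>)"

definition reduced_list :: "('g \<times> 'e) list \<Rightarrow> bool" where
  "reduced_list u \<longleftrightarrow> (\<forall>p\<in>set u. fst p \<in> \<Sigma> (snd p)) \<and> successively no_backtrack u"

lemma reduced_list_Nil [simp]: "reduced_list []"
  by (simp add: reduced_list_def)

lemma reduced_list_snoc:
  "reduced_list (u @ [p]) \<longleftrightarrow>
    reduced_list u \<and> fst p \<in> \<Sigma> (snd p) \<and> (u \<noteq> [] \<longrightarrow> no_backtrack (last u) p)"
  by (auto simp: reduced_list_def successively_append_iff)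

lemma reduced_word_iff: "reduced_word \<G> \<Sigma> w \<longleftrightarrow> is_word \<G> w \<and> reduced_list (body w)"
  by (auto simp: reduced_word_def reduced_list_def successively_conv_nth no_backtrack_def
      case_prod_beta)

definition reduced_between :: "'v \<Rightarrow> ('v, 'e, 'g) Defs.word \<Rightarrow> 'v \<Rightarrow> bool" where
  "reduced_between x w y \<longleftrightarrow> word_between x w y \<and> reduced_list (body w)"

lemma reduced_between_Word [simp]:
  "reduced_between x (Word x' u h) y \<longleftrightarrow> x' = x \<and> walk x u y \<and> h \<in> vcarrier y \<and> reduced_list u"
  by (auto simp: reduced_between_def)

lemma reduced_betweenE:
  assumes "reduced_between x w y"
  obtains u h where "w = Word x u h" "walk x u y" "h \<in> vcarrier y" "reduced_list u"
  using assms by (cases w) auto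

lemma reduced_between_imp_word_between: "reduced_between x w y \<Longrightarrow> word_between x w y"
  by (simp add: reduced_between_def)

text \<open>The normal form of \<open>S\<close> followed by the letter \<open>(g, f)\<close>. The
  product of \<open>a\<close> and \<open>g\<close> is split as \<open>s\<close> times an edge group
  element, which passes through \<open>f\<close>. If \<open>s\<close> is trivial and the last edge
  is the reverse of \<open>f\<close>, the pair of edges disappears and the transported element joins
  the group element in front of the removed edge.\<close>

fun step :: "('v, 'e, 'g) Defs.word \<Rightarrow> 'g \<times> 'e \<Rightarrow> ('v, 'e, 'g) Defs.word" where
  "step (Word x u a) (g, f) = (case decompose f (a \<cdot>\<^bsub>rng \<G> f\<^esub> g) of (s, k) \<Rightarrow>
     if u \<noteq> [] \<and> snd (last u) = opp \<G> f \<and> s = 1\<^bsub>rng \<G> f\<^esub>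
     then Word x (butlast u) (fst (last u) \<cdot>\<^bsub>src \<G> f\<^esub> emb \<G> (opp \<G> f) k)
     else Word x (u @ [(s, f)]) (emb \<G> (opp \<G> f) k))"

lemma step_cancel:
  assumes "f \<in> edges \<G>" "k \<in> ecarrier f" "a \<cdot>\<^bsub>rng \<G> f\<^esub> g = emb \<G> f k"
  shows "step (Word x (u @ [(h, opp \<G> f)]) a) (g, f) =
    Word x u (h \<cdot>\<^bsub>src \<G> f\<^esub> emb \<G> (opp \<G> f) k)"
  using assms decompose_eqI[of f "1\<^bsub>rng \<G> f\<^esub>" k "emb \<G> f k"] by simp

lemma step_append:
  assumes "f \<in> edges \<G>" "s \<in> \<Sigma> f" "k \<in> ecarrier f" "a \<cdot>\<^bsub>rng \<G> f\<^esub> g = s \<cdot>\<^bsub>rng \<G> f\<^esub> emb \<G> f k"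
    and "u = [] \<or> no_backtrack (last u) (s, f)"
  shows "step (Word x u a) (g, f) = Word x (u @ [(s, f)]) (emb \<G> (opp \<G> f) k)"
  using assms decompose_eqI[OF assms(1-4)] by (auto simp: no_backtrack_def)

lemma step_cases:
  assumes f: "f \<in> edges \<G>" and a: "a \<in> vcarrier (rng \<G> f)" and g: "g \<in> vcarrier (rng \<G> f)"
  obtains (cancel) u' h k where "u = u' @ [(h, opp \<G> f)]" "k \<in> ecarrier f"
      "a \<cdot>\<^bsub>rng \<G> f\<^esub> g = emb \<G> f k"
      "step (Word x u a) (g, f) = Word x u' (h \<cdot>\<^bsub>src \<G> f\<^esub> emb \<G> (opp \<G> f) k)"
  | (append) s k where "s \<in> \<Sigma> f" "k \<in> ecarrier f"
      "a \<cdot>\<^bsub>rng \<G> f\<^esub> g = s \<cdot>\<^bsub>rng \<G> f\<^esub> emb \<G> f k" "u = [] \<or> no_backtrack (last u) (s, f)"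
      "step (Word x u a) (g, f) = Word x (u @ [(s, f)]) (emb \<G> (opp \<G> f) k)"
proof -
  obtain s k where sk: "s \<in> \<Sigma> f" "k \<in> ecarrier f" "a \<cdot>\<^bsub>rng \<G> f\<^esub> g = s \<cdot>\<^bsub>rng \<G> f\<^esub> emb \<G> f k"
    using decomposeE[OF f, of "a \<cdot>\<^bsub>rng \<G> f\<^esub> g"] f a g by (metis vmult_closed rng_in)
  show ?thesis
  proof (cases "u = [] \<or> no_backtrack (last u) (s, f)")
    case True
    then show ?thesis using append sk step_append[OF f sk] by blast
  next
    case False
    then obtain u' h where u: "u = u' @ [(h, opp \<G> f)]" and "s = 1\<^bsub>rng \<G> f\<^esub>"
      by (cases u rule: rev_cases) (auto simp: no_backtrack_def)
    then have "a \<cdot>\<^bsub>rng \<G> f\<^esub> g = emb \<G> f k" using sk f by simp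
    then show ?thesis using cancel[OF u sk(2)] step_cancel[OF f sk(2)] u by blast
  qed
qed

text \<open>Dropping the last letter keeps a list reduced, and a letter is appended only where no
  backtracking arises. The equivalence comes from sliding \<open>k\<close> through \<open>f\<close>
  and, in the first branch, cancelling the pair of edges.\<close>

lemma step_reduced_between:
  assumes S: "reduced_between x S (rng \<G> f)" and f: "f \<in> edges \<G>" and g: "g \<in> vcarrier (rng \<G> f)"
  shows "reduced_between x (step S (g, f)) (src \<G> f)"
    and "fg_eq \<G> (cat \<G> S (Word (rng \<G> f) [(g, f)] 1\<^bsub>src \<G> f\<^esub>)) (step S (g, f))"
proof -
  obtain u a where S: "S = Word x u a" and u: "walk x u (rng \<G> f)" "reduced_list u"
    and a: "a \<in> vcarrier (rng \<G> f)" using S by (rule reduced_betweenE)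
  let ?w = "cat \<G> S (Word (rng \<G> f) [(g, f)] 1\<^bsub>src \<G> f\<^esub>)"
  have w: "?w = Word x (u @ [(a \<cdot>\<^bsub>rng \<G> f\<^esub> g, f)]) 1\<^bsub>src \<G> f\<^esub>" using S by simp
  have slide: "fg_eq \<G> ?w (Word x (u @ [(s, f)]) (emb \<G> (opp \<G> f) k))"
    if "s \<in> \<Sigma> f" "k \<in> ecarrier f" "a \<cdot>\<^bsub>rng \<G> f\<^esub> g = s \<cdot>\<^bsub>rng \<G> f\<^esub> emb \<G> f k" for s k
    unfolding w that(3) using that(1,2) f by (intro fg_eq_slide u) simp_all
  from f a g have "reduced_between x (step S (g, f)) (src \<G> f) \<and> fg_eq \<G> ?w (step S (g, f))"
  proof (cases rule: step_cases[where u = u and x = x])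
    case (cancel u' h k)
    have "fg_eq \<G> (Word x (u @ [(1\<^bsub>rng \<G> f\<^esub>, f)]) (emb \<G> (opp \<G> f) k))
        (Word x u' (h \<cdot>\<^bsub>src \<G> f\<^esub> emb \<G> (opp \<G> f) k))"
      using fg_eq_cancel[of x u' "opp \<G> f" h "emb \<G> (opp \<G> f) k"] cancel u f by simp
    then show ?thesis
      using slide[of "1\<^bsub>rng \<G> f\<^esub>" k] cancel u f S fg_eq.trans by (auto simp: reduced_list_snoc)
  next
    case (append s k)
    then show ?thesis using slide[of s k] u f S by (auto simp: reduced_list_snoc)
  qed
  then show "reduced_between x (step S (g, f)) (src \<G> f)" "fg_eq \<G> ?w (step S (g, f))" by auto
qed

text \<open>This makes the relation that cancels \<open>e\<close> against its reverse hold in the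
  action. If the first step removes a letter \<open>(h, opp \<G> e)\<close>, reducedness of
  \<open>S\<close> puts \<open>h\<close> into the transversal and excludes backtracking, so the
  second step restores exactly that letter; if the first step appends, the second removes the
  appended letter.\<close>

lemma step_inverse:
  assumes S: "reduced_between x S (rng \<G> e)" and e: "e \<in> edges \<G>"
  shows "step (step S (1\<^bsub>rng \<G> e\<^esub>, e)) (1\<^bsub>src \<G> e\<^esub>, opp \<G> e) = S"
proof -
  obtain u a where S: "S = Word x u a" and u: "walk x u (rng \<G> e)" "reduced_list u"
    and a: "a \<in> vcarrier (rng \<G> e)" using S by (rule reduced_betweenE)
  from e a vone_closed[OF rng_in[OF e]] show ?thesis
  proof (cases rule: step_cases[where u = u and x = x])
    case (cancel u' h k)
    have h: "h \<in> \<Sigma> (opp \<G> e)" "u' = [] \<or> no_backtrack (last u') (h, opp \<G> e)" "h \<in> vcarrier (src \<G> e)"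
      using u cancel e by (auto simp: reduced_list_snoc)
    have "step (Word x u' (h \<cdot>\<^bsub>src \<G> e\<^esub> emb \<G> (opp \<G> e) k)) (1\<^bsub>src \<G> e\<^esub>, opp \<G> e)
        = Word x (u' @ [(h, opp \<G> e)]) (emb \<G> (opp \<G> (opp \<G> e)) k)"
      using e cancel h by (intro step_append) simp_all
    then show ?thesis using S cancel a e by simp
  next
    case (append s k)
    have "step (Word x (u @ [(s, opp \<G> (opp \<G> e))]) (emb \<G> (opp \<G> e) k)) (1\<^bsub>src \<G> e\<^esub>, opp \<G> e)
        = Word x u (s \<cdot>\<^bsub>src \<G> (opp \<G> e)\<^esub> emb \<G> (opp \<G> (opp \<G> e)) k)"
      using e append by (intro step_cancel) simp_all
    then show ?thesis using S append a e by simp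
  qed
qed

text \<open>Right multiplication by \<open>emb \<G> e g\<close> does not change the coset, so both
  sides take the same branch with the same \<open>s\<close>; only the edge group element changes,
  from \<open>k\<close> to the product of \<open>k\<close> and \<open>g\<close>.\<close>

lemma step_slide:
  assumes S: "reduced_between x S (rng \<G> e)" and e: "e \<in> edges \<G>" and g: "g \<in> ecarrier e"
  shows "cat \<G> (step S (1\<^bsub>rng \<G> e\<^esub>, e)) (Word (src \<G> e) [] (emb \<G> (opp \<G> e) g)) =
    step S (emb \<G> e g, e)"
proof -
  obtain u a where S: "S = Word x u a" and u: "walk x u (rng \<G> e)" "reduced_list u"
    and a: "a \<in> vcarrier (rng \<G> e)" using S by (rule reduced_betweenE)
  from e a vone_closed[OF rng_in[OF e]] show ?thesis
  proof (cases rule: step_cases[where u = u and x = x])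
    case (cancel u' h k)
    have "h \<in> vcarrier (src \<G> e)" using u cancel e by auto
    moreover have "step (Word x (u' @ [(h, opp \<G> e)]) a) (emb \<G> e g, e) =
        Word x u' (h \<cdot>\<^bsub>src \<G> e\<^esub> emb \<G> (opp \<G> e) (k \<otimes>\<^bsub>egrp \<G> e\<^esub> g))"
      using e a g cancel by (intro step_cancel) (simp_all add: emb_mult)
    ultimately show ?thesis using S cancel e g by (simp add: emb_mult vmult_assoc)
  next
    case (append s k)
    then have "step (Word x u a) (emb \<G> e g, e) =
        Word x (u @ [(s, e)]) (emb \<G> (opp \<G> e) (k \<otimes>\<^bsub>egrp \<G> e\<^esub> g))"
      using e a g append by (intro step_append) (simp_all add: emb_mult vmult_assoc)
    then show ?thesis using S append e g by (simp add: emb_mult)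
  qed
qed

lemma step_absorb:
  assumes "reduced_between x S (rng \<G> f)" "f \<in> edges \<G>"
    and "h \<in> vcarrier (rng \<G> f)" "g \<in> vcarrier (rng \<G> f)"
  shows "step (cat \<G> S (Word (rng \<G> f) [] h)) (g, f) = step S (h \<cdot>\<^bsub>rng \<G> f\<^esub> g, f)"
  using assms by (auto elim!: reduced_betweenE simp: vmult_assoc)

text \<open>Words act from the right on reduced words. This action factors through the fundamental
  groupoid (van der Waerden's argument), which makes reduced words unique in their class.\<close>

definition act :: "('v, 'e, 'g) Defs.word \<Rightarrow> ('v, 'e, 'g) Defs.word \<Rightarrow> ('v, 'e, 'g) Defs.word" where
  "act S w = cat \<G> (foldl step S (body w)) (Word (word_src \<G> w) [] (final w))"

lemma foldl_step:
  assumes S: "reduced_between x S y" and u: "walk y u z"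
  shows "reduced_between x (foldl step S u) z \<and>
    fg_eq \<G> (cat \<G> S (Word y u 1\<^bsub>z\<^esub>)) (foldl step S u)"
  using u
proof (induction u arbitrary: z rule: rev_induct)
  case Nil
  then show ?case using S cat_unit(1) fg_eq_refl by (auto simp: reduced_between_def)
next
  case (snoc p u)
  obtain g f where p: "p = (g, f)" by fastforce
  have f: "f \<in> edges \<G>" "src \<G> f = z" "g \<in> vcarrier (rng \<G> f)" "walk y u (rng \<G> f)"
    using snoc.prems p by auto
  let ?l = "Word (rng \<G> f) [(g, f)] 1\<^bsub>z\<^esub>" and ?u = "Word y u 1\<^bsub>rng \<G> f\<^esub>"
  have IH: "reduced_between x (foldl step S u) (rng \<G> f)"
    "fg_eq \<G> (cat \<G> S ?u) (foldl step S u)" using snoc.IH f by auto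
  have l: "word_between (rng \<G> f) ?l z" and S': "word_between x S y" and u': "word_between y ?u (rng \<G> f)"
    using f S by (auto simp: reduced_between_def)
  have "Word y (u @ [p]) 1\<^bsub>z\<^esub> = cat \<G> ?u ?l" using f p by simp
  then have "cat \<G> S (Word y (u @ [p]) 1\<^bsub>z\<^esub>) = cat \<G> (cat \<G> S ?u) ?l"
    using cat_assoc[OF S' u' l] by simp
  moreover have "fg_eq \<G> (cat \<G> (cat \<G> S ?u) ?l) (cat \<G> (foldl step S u) ?l)"
    by (rule fg_eq_cat_right[OF IH(2) word_between_cat[OF S' u'] l])
  moreover have "fg_eq \<G> (cat \<G> (foldl step S u) ?l) (step (foldl step S u) p)"
    using step_reduced_between(2)[OF IH(1) f(1,3)] f p by simp
  ultimately show ?case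
    using step_reduced_between(1)[OF IH(1) f(1,3)] f p fg_eq.trans by simp blast
qed

lemma act_Word: "walk y u z \<Longrightarrow> act S (Word y u h) = cat \<G> (foldl step S u) (Word z [] h)"
  using walk_src[of y u z] by (cases "u = []") (auto simp: act_def word_src_def)

lemma act_reduced_between:
  assumes S: "reduced_between x S y" and w: "word_between y w z"
  shows "reduced_between x (act S w) z" and "fg_eq \<G> (cat \<G> S w) (act S w)"
proof -
  obtain u h where w: "w = Word y u h" and u: "walk y u z" "h \<in> vcarrier z"
    using w by (rule word_betweenE)
  have z: "z \<in> verts \<G>" using u walk_verts by blast
  note F = foldl_step[OF S u(1)]
  show "reduced_between x (act S w) z"
    using conjunct1[OF F] u z by (auto simp: w act_Word elim!: reduced_betweenE)
  have h: "word_between z (Word z [] h) z" and S': "word_between x S y"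
    and u': "word_between y (Word y u 1\<^bsub>z\<^esub>) z"
    using u z S by (auto simp: reduced_between_def)
  have "w = cat \<G> (Word y u 1\<^bsub>z\<^esub>) (Word z [] h)" using u z w by simp
  then have "cat \<G> S w = cat \<G> (cat \<G> S (Word y u 1\<^bsub>z\<^esub>)) (Word z [] h)"
    using cat_assoc[OF S' u' h] by simp
  then show "fg_eq \<G> (cat \<G> S w) (act S w)"
    using fg_eq_cat_right[OF conjunct2[OF F] word_between_cat[OF S' u'] h] by (simp add: w act_Word[OF u(1)])
qed

text \<open>The two sides differ only at the junction, where \<open>cat\<close> merges the final
  element of \<open>p\<close> with the first letter of \<open>q\<close>; by
  \<open>step_absorb\<close>, only that product matters.\<close>

lemma act_cat:
  assumes S: "reduced_between x S y" and p: "word_between y p z" and q: "word_between z q t"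
  shows "act S (cat \<G> p q) = act (act S p) q"
proof -
  obtain u h where p: "p = Word y u h" and u: "walk y u z" "h \<in> vcarrier z"
    using p by (rule word_betweenE)
  obtain v k where q: "q = Word z v k" and v: "walk z v t" "k \<in> vcarrier t"
    using q by (rule word_betweenE)
  have F: "reduced_between x (foldl step S u) z" using foldl_step[OF S u(1)] ..
  show ?thesis
  proof (cases v)
    case Nil
    then show ?thesis using F u v
      by (auto simp: p q act_Word elim!: reduced_betweenE simp: vmult_assoc)
  next
    case (Cons l v')
    obtain g f where l: "l = (g, f)" by fastforce
    have f: "f \<in> edges \<G>" "rng \<G> f = z" "g \<in> vcarrier (rng \<G> f)" "walk (src \<G> f) v' t"
      using v Cons l by auto
    have "walk y (u @ (h \<cdot>\<^bsub>z\<^esub> g, f) # v') t" using f u by (auto simp: walk_append)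
    then have "act S (cat \<G> p q) = cat \<G> (foldl step (step (foldl step S u) (h \<cdot>\<^bsub>z\<^esub> g, f)) v') (Word t [] k)"
      using Cons l by (simp add: p q act_Word)
    also have "step (foldl step S u) (h \<cdot>\<^bsub>z\<^esub> g, f) = step (act S p) l"
      using step_absorb[of x "foldl step S u" f h g] F f u l by (simp add: p act_Word)
    finally show ?thesis by (simp only: q act_Word[OF v(1)]) (simp add: Cons)
  qed
qed

text \<open>The two defining relations are \<open>step_inverse\<close> and
  \<open>step_slide\<close>; \<open>act_cat\<close> carries them into contexts, whose left part
  changes \<open>S\<close>.\<close>

lemma act_respects_fg_eq:
  assumes "fg_eq \<G> w w'" "word_between y w z" "reduced_between x S y"
  shows "act S w = act S w'"
  using assms
proof (induction arbitrary: x y z S rule: fg_eq.induct)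
  case (sym w w')
  then show ?case using fg_eq_transfer fg_eq.sym by metis
next
  case (trans w w' w'')
  then show ?case using fg_eq_transfer by metis
next
  case (cong w w' p q)
  obtain a b where w: "word_between a w b" "word_between a w' b"
    using cong.hyps fg_eq_word_between by blast
  have p: "word_between (word_rng p) p a" and q: "word_between b q (word_src \<G> q)"
    using cong w by (simp_all add: word_between_def)
  have y: "y = word_rng p"
    using word_between_unique[OF cong.prems(1) word_between_cat[OF p word_between_cat[OF w(1) q]]]
    by simp
  then have S: "reduced_between x S (word_rng p)" using cong.prems by simp
  have Sp: "reduced_between x (act S p) a" using act_reduced_between(1)[OF S p] .
  have "act S (cat \<G> p (cat \<G> w'' q)) = act (act (act S p) w'') q" if "word_between a w'' b" for w''
    using act_cat[OF S p word_between_cat[OF that q]] act_cat[OF Sp that q] by simp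
  then show ?case using cong.IH[OF w(1) Sp] w by simp
next
  case (cancel e)
  then have "y = rng \<G> e" by simp
  then show ?case using cancel step_inverse[of x S e]
    by (simp add: act_def word_src_def)
next
  case (slide e g)
  then have y: "y = rng \<G> e" by simp
  then have "word_between x (step S (emb \<G> e g, e)) (src \<G> e)"
    using step_reduced_between(1)[of x S e "emb \<G> e g"] slide by (simp add: reduced_between_def)
  then show ?case using slide step_slide[of x S e g] y cat_unit(1)
    by (simp add: act_def word_src_def)
qed simp

text \<open>Each letter already lies in its transversal, so its factorization has trivial edge group
  part, and the absence of backtracking rules out cancellation.\<close>

lemma foldl_step_reduced:
  assumes "walk x u y" "reduced_list u"
  shows "foldl step (Word x [] 1\<^bsub>x\<^esub>) u = Word x u 1\<^bsub>y\<^esub>"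
  using assms
proof (induction u arbitrary: y rule: rev_induct)
  case (snoc p u)
  obtain g f where p: "p = (g, f)" by fastforce
  have f: "f \<in> edges \<G>" "src \<G> f = y" "walk x u (rng \<G> f)" "g \<in> \<Sigma> f" "reduced_list u"
    "u = [] \<or> no_backtrack (last u) (g, f)"
    using snoc.prems p by (auto simp: reduced_list_snoc)
  have "step (Word x u 1\<^bsub>rng \<G> f\<^esub>) (g, f) = Word x (u @ [(g, f)]) (emb \<G> (opp \<G> f) \<one>\<^bsub>egrp \<G> f\<^esub>)"
    using f by (intro step_append) simp_all
  then show ?case using snoc.IH f p by simp
qed simp

lemma act_reduced_between_unit:
  assumes "reduced_between x w y"
  shows "act (Word x [] 1\<^bsub>x\<^esub>) w = w"
proof -
  obtain u h where "w = Word x u h" "walk x u y" "h \<in> vcarrier y" "reduced_list u"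
    using assms by (rule reduced_betweenE)
  then show ?thesis using foldl_step_reduced walk_verts by (auto simp: act_Word)
qed

text \<open>Any reduced \<open>w'\<close> in the class equals its own action on the trivial word,
  and this action depends only on the class.\<close>

lemma reduced_form_class:
  assumes w: "word_between x w y"
  shows "reduced_form \<G> \<Sigma> (fg_class \<G> w) = act (Word x [] 1\<^bsub>x\<^esub>) w"
  unfolding reduced_form_def
proof (rule the_equality)
  have x: "reduced_between x (Word x [] 1\<^bsub>x\<^esub>) x" using w word_between_verts by simp
  show "act (Word x [] 1\<^bsub>x\<^esub>) w \<in> fg_class \<G> w \<and> reduced_word \<G> \<Sigma> (act (Word x [] 1\<^bsub>x\<^esub>) w)"
    using act_reduced_between[OF x w] cat_unit(2)[OF w]
    by (auto simp: fg_class_def reduced_word_iff reduced_between_def word_between_def)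
  fix w' assume w': "w' \<in> fg_class \<G> w \<and> reduced_word \<G> \<Sigma> w'"
  then have "reduced_between x w' y"
    using fg_eq_transfer[OF _ w] by (simp add: reduced_between_def fg_class_def reduced_word_iff)
  then show "w' = act (Word x [] 1\<^bsub>x\<^esub>) w"
    using act_reduced_between_unit act_respects_fg_eq[OF _ w x] w' unfolding fg_class_def by auto
qed

subsection \<open>Infinite reduced paths\<close>

lemma is_path_Word:
  "is_path \<G> \<Sigma> (Word x u h) \<longleftrightarrow> (\<exists>y. walk x u y \<and> reduced_list u \<and> h = 1\<^bsub>y\<^esub>)"
proof -
  have "word_src \<G> (Word x u h) = y" if "walk x u y" for y
    using walk_src[OF that] by (auto simp: word_src_def split: if_splits)
  then show ?thesis
    using walk_verts by (fastforce simp: is_path_def reduced_word_iff is_word_def word_from_iff)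
qed

text \<open>Being reduced concerns adjacent letters only, so pairs of consecutive letters can
  replace the initial segments.\<close>

lemma boundary_iff:
  "\<xi> \<in> boundary \<G> \<Sigma> \<longleftrightarrow> (\<forall>i. snd (\<xi> i) \<in> edges \<G> \<and> fst (\<xi> i) \<in> \<Sigma> (snd (\<xi> i)) \<and>
    rng \<G> (snd (\<xi> (Suc i))) = src \<G> (snd (\<xi> i)) \<and> no_backtrack (\<xi> i) (\<xi> (Suc i)))"
    (is "_ \<longleftrightarrow> ?R \<xi>")
proof
  assume \<xi>: "\<xi> \<in> boundary \<G> \<Sigma>"
  show "?R \<xi>"
  proof
    fix i
    \<comment> \<open>The prefix of length \<open>i + 2\<close> is the shortest that contains both
      letters.\<close>
    obtain y where "walk (inf_rng \<G> \<xi>) (prefix (Suc (Suc i)) \<xi>) y"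
      "reduced_list (prefix (Suc (Suc i)) \<xi>)"
      using \<xi> unfolding boundary_def mem_Collect_eq segment_def by (metis is_path_Word subsequence_def)
    then show "snd (\<xi> i) \<in> edges \<G> \<and> fst (\<xi> i) \<in> \<Sigma> (snd (\<xi> i)) \<and>
        rng \<G> (snd (\<xi> (Suc i))) = src \<G> (snd (\<xi> i)) \<and> no_backtrack (\<xi> i) (\<xi> (Suc i))"
      by (auto simp: walk_append reduced_list_def successively_append_iff)
  qed
next
  assume R: "?R \<xi>"
  have "walk (inf_rng \<G> \<xi>) (prefix n \<xi>) (rng \<G> (snd (\<xi> n))) \<and> reduced_list (prefix n \<xi>)" for n
  proof (induction n)
    case 0
    then show ?case using R by (simp add: inf_rng_def)
  next
    case (Suc n)
    have "prefix n \<xi> = [] \<or> no_backtrack (last (prefix n \<xi>)) (\<xi> n)"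
      using R by (cases n) simp_all
    then show ?case using R Suc by (auto simp: reduced_list_snoc)
  qed
  moreover have "segment \<G> \<xi> n = Word (inf_rng \<G> \<xi>) (prefix n \<xi>) 1\<^bsub>rng \<G> (snd (\<xi> n))\<^esub>" for n
    using R by (cases n) (simp_all add: segment_def subsequence_def inf_rng_def)
  ultimately have "is_path \<G> \<Sigma> (segment \<G> \<xi> n)" for n
    using is_path_Word by metis
  then show "\<xi> \<in> boundary \<G> \<Sigma>" by (simp add: boundary_def)
qed

text \<open>Writing the end vertex as the range of the next edge removes the case
  \<open>n = 0\<close> from \<open>segment\<close>.\<close>

lemma boundary_prefix:
  assumes "\<xi> \<in> boundary \<G> \<Sigma>"
  shows "walk (inf_rng \<G> \<xi>) (prefix n \<xi>) (rng \<G> (snd (\<xi> n)))" "reduced_list (prefix n \<xi>)"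
    and "segment \<G> \<xi> n = Word (inf_rng \<G> \<xi>) (prefix n \<xi>) 1\<^bsub>rng \<G> (snd (\<xi> n))\<^esub>"
proof -
  have R: "rng \<G> (snd (\<xi> (Suc i))) = src \<G> (snd (\<xi> i))" for i
    using assms by (simp add: boundary_iff)
  show seg: "segment \<G> \<xi> n = Word (inf_rng \<G> \<xi>) (prefix n \<xi>) 1\<^bsub>rng \<G> (snd (\<xi> n))\<^esub>"
    by (cases n) (simp_all add: segment_def subsequence_def inf_rng_def R)
  obtain y where y: "walk (inf_rng \<G> \<xi>) (prefix n \<xi>) y" "reduced_list (prefix n \<xi>)"
    using assms seg unfolding boundary_def mem_Collect_eq by (metis is_path_Word)
  then show "reduced_list (prefix n \<xi>)" by simp
  have "y = rng \<G> (snd (\<xi> n))" using walk_src[OF y(1)] by (cases n) (auto simp: inf_rng_def R)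
  then show "walk (inf_rng \<G> \<xi>) (prefix n \<xi>) (rng \<G> (snd (\<xi> n)))" using y by simp
qed

lemma boundary_suffix: "\<xi> \<in> boundary \<G> \<Sigma> \<Longrightarrow> suffix n \<xi> \<in> boundary \<G> \<Sigma>"
  by (simp add: boundary_iff)

lemma boundary_conc:
  assumes "walk x u (inf_rng \<G> \<xi>)" "reduced_list u" "\<xi> \<in> boundary \<G> \<Sigma>"
    and "u = [] \<or> no_backtrack (last u) (\<xi> 0)"
  shows "u \<frown> \<xi> \<in> boundary \<G> \<Sigma> \<and> inf_rng \<G> (u \<frown> \<xi>) = x"
  using assms
proof (induction u arbitrary: \<xi> rule: rev_induct)
  case (snoc p u)
  have "p ## \<xi> \<in> boundary \<G> \<Sigma>"
    unfolding boundary_iff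
  proof
    fix i
    show "snd ((p ## \<xi>) i) \<in> edges \<G> \<and> fst ((p ## \<xi>) i) \<in> \<Sigma> (snd ((p ## \<xi>) i)) \<and>
        rng \<G> (snd ((p ## \<xi>) (Suc i))) = src \<G> (snd ((p ## \<xi>) i)) \<and>
        no_backtrack ((p ## \<xi>) i) ((p ## \<xi>) (Suc i))"
      using snoc.prems by (cases i) (auto simp: boundary_iff reduced_list_snoc inf_rng_def)
  qed
  then show ?case using snoc.prems snoc.IH[of "p ## \<xi>"]
    by (auto simp: reduced_list_snoc inf_rng_def)
qed simp

text \<open>\<open>no_backtrack\<close> ignores the group element of its first letter, so whatever
  may follow \<open>\<xi> n\<close> may also follow the last letter of \<open>u\<close>, even if
  these two letters differ.\<close>

lemma boundary_graft:
  assumes u: "walk x u y" "reduced_list u" "u \<noteq> []" and \<xi>: "\<xi> \<in> boundary \<G> \<Sigma>"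
    and last: "snd (last u) = snd (\<xi> n)"
  shows "u \<frown> suffix (Suc n) \<xi> \<in> boundary \<G> \<Sigma> \<and> inf_rng \<G> (u \<frown> suffix (Suc n) \<xi>) = x"
proof (rule boundary_conc)
  have R: "rng \<G> (snd (\<xi> (Suc n))) = src \<G> (snd (\<xi> n))" "no_backtrack (\<xi> n) (\<xi> (Suc n))"
    using \<xi> by (simp_all add: boundary_iff)
  then show "walk x u (inf_rng \<G> (suffix (Suc n) \<xi>))"
    using u last walk_src[OF u(1)] by (simp add: inf_rng_def)
  show "u = [] \<or> no_backtrack (last u) (suffix (Suc n) \<xi> 0)"
    using R last by (simp add: no_backtrack_def)
qed (rule u(2) boundary_suffix[OF \<xi>])+

text \<open>This is where nonsingularity enters. An edge with range \<open>src \<G> e\<close> other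
  than the reverse of \<open>e\<close> continues with trivial group element. If there is none,
  nonsingularity at the reverse of \<open>e\<close> gives a second coset, whose representative is
  not 1.\<close>

lemma ex_continuation:
  assumes "nonsingular \<G>" and e: "e \<in> edges \<G>"
  shows "\<exists>p. snd p \<in> edges \<G> \<and> fst p \<in> \<Sigma> (snd p) \<and> rng \<G> (snd p) = src \<G> e \<and> no_backtrack (g, e) p"
proof (cases "{f \<in> edges \<G>. rng \<G> f = src \<G> e} = {opp \<G> e}")
  case False
  then obtain f where f: "f \<in> edges \<G>" "rng \<G> f = src \<G> e" "f \<noteq> opp \<G> e" using e by auto
  then have "e \<noteq> opp \<G> f" by (metis opp_opp)
  with f one_in_transversal[OF f(1)] show ?thesis
    by (intro exI[of _ "(1\<^bsub>rng \<G> f\<^esub>, f)"]) (simp add: no_backtrack_def)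
next
  case True
  let ?f = "opp \<G> e"
  have f: "?f \<in> edges \<G>" using e by simp
  have "{f \<in> edges \<G>. rng \<G> f = rng \<G> ?f} = {?f}" using True e by simp
  then have "infinite (edge_cosets \<G> ?f) \<or> card (edge_cosets \<G> ?f) > 1"
    using assms(1) f unfolding nonsingular_def by blast
  moreover have "finite (edge_cosets \<G> ?f) \<and> card (edge_cosets \<G> ?f) \<le> 1"
    if "edge_cosets \<G> ?f \<subseteq> {edge_subgroup \<G> ?f}"
    using finite_subset[OF that] card_mono[OF _ that] by simp
  ultimately have "\<not> edge_cosets \<G> ?f \<subseteq> {edge_subgroup \<G> ?f}" by linarith
  then obtain C where C: "C \<in> edge_cosets \<G> ?f" "C \<noteq> edge_subgroup \<G> ?f" by blast
  then obtain s where s: "s \<in> \<Sigma> ?f" "s \<in> C"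
    using transversals f unfolding transversals_def by metis
  interpret group "vgrp \<G> (rng \<G> ?f)" using f group_vgrp by simp
  interpret H: subgroup "edge_subgroup \<G> ?f" "vgrp \<G> (rng \<G> ?f)" using f by (rule edge_subgroup)
  \<comment> \<open>The coset that contains 1 is the edge subgroup itself, and distinct cosets are
    disjoint.\<close>
  have "s \<noteq> 1\<^bsub>rng \<G> ?f\<^esub>"
  proof
    assume "s = 1\<^bsub>rng \<G> ?f\<^esub>"
    then have "s \<in> edge_subgroup \<G> ?f" "edge_subgroup \<G> ?f \<in> edge_cosets \<G> ?f"
      using lcos_mult_one[OF H.subset] unfolding edge_cosets_def LCOSETS_def by auto
    then show False
      using lcos_disjoint[OF H.subgroup_axioms] C s unfolding edge_cosets_def by blast
  qed
  then show ?thesis using e f s by (intro exI[of _ "(s, ?f)"]) (auto simp: no_backtrack_def)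
qed

text \<open>Dependent choice iterates \<open>ex_continuation\<close>; the index in \<open>?P\<close>
  serves to prescribe the first letter. Hence the cylinder of \<open>edge_path \<G> e\<close> is not
  empty.\<close>

lemma ex_boundary_from_edge:
  assumes "nonsingular \<G>" and e: "e \<in> edges \<G>"
  shows "\<exists>\<zeta>\<in>boundary \<G> \<Sigma>. \<zeta> 0 = (1\<^bsub>rng \<G> e\<^esub>, e)"
proof -
  let ?P = "\<lambda>n p. snd p \<in> edges \<G> \<and> fst p \<in> \<Sigma> (snd p) \<and> (n = 0 \<longrightarrow> p = (1\<^bsub>rng \<G> e\<^esub>, e))"
  have "\<exists>\<zeta>. \<forall>n::nat. ?P n (\<zeta> n) \<and>
      (rng \<G> (snd (\<zeta> (Suc n))) = src \<G> (snd (\<zeta> n)) \<and> no_backtrack (\<zeta> n) (\<zeta> (Suc n)))"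
  proof (rule dependent_nat_choice)
    show "\<exists>p. ?P 0 p" using e by auto
    fix p and n :: nat assume "?P n p"
    then show "\<exists>q. ?P (Suc n) q \<and> (rng \<G> (snd q) = src \<G> (snd p) \<and> no_backtrack p q)"
      using ex_continuation[OF assms(1), of "snd p" "fst p"] by auto
  qed
  then obtain \<zeta> where \<zeta>: "\<forall>n. ?P n (\<zeta> n) \<and>
      (rng \<G> (snd (\<zeta> (Suc n))) = src \<G> (snd (\<zeta> n)) \<and> no_backtrack (\<zeta> n) (\<zeta> (Suc n)))" ..
  show ?thesis by (rule bexI[of _ \<zeta>]) (use \<zeta> in \<open>simp_all add: boundary_iff\<close>)
qed

lemma ex_reduced_walk:
  assumes "x \<in> verts \<G>" "y \<in> verts \<G>"
  shows "\<exists>u. walk x u y \<and> reduced_list u"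
proof -
  have "(x, y) \<in> {(rng \<G> e, src \<G> e) | e. e \<in> edges \<G>}\<^sup>*"
    using connected assms by (simp add: connected_graph_def)
  then show ?thesis
  proof induction
    case base
    show ?case using assms by (intro exI[of _ "[]"]) simp
  next
    case (step y z)
    then obtain e u where e: "e \<in> edges \<G>" "y = rng \<G> e" "z = src \<G> e"
      and u: "walk x u y" "reduced_list u" by blast
    then have "reduced_between x (Word x u 1\<^bsub>rng \<G> e\<^esub>) (rng \<G> e)" by simp
    \<comment> \<open>Reading the next edge through \<open>step\<close> reduces as it goes: the list
      may become shorter, but it still ends at \<open>z\<close>.\<close>
    from step_reduced_between(1)[OF this e(1), of "1\<^bsub>rng \<G> e\<^esub>"]
    show ?case using e by (auto elim!: reduced_betweenE)
  qed
qed

text \<open>If the walk to the start of \<open>\<xi>\<close> cannot be continued by \<open>\<xi>\<close>, it ends with the reverse of the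
  first edge of \<open>\<xi>\<close>; dropping both gives a shorter walk to a tail of \<open>\<xi>\<close>.\<close>

lemma ex_walk_to_tail:
  assumes "\<xi> \<in> boundary \<G> \<Sigma>" "walk x u (inf_rng \<G> \<xi>)" "reduced_list u"
  shows "\<exists>w n y. walk x w y \<and> reduced_list w \<and> w \<noteq> [] \<and> snd (last w) = snd (\<xi> n)"
  using assms
proof (induction u arbitrary: \<xi> rule: rev_induct)
  case Nil
  then have "walk x [\<xi> 0] (src \<G> (snd (\<xi> 0)))" "reduced_list [\<xi> 0]"
    using boundary_prefix[of \<xi> 1] by (auto simp: boundary_iff)
  then show ?case by (intro exI[of _ "[\<xi> 0]"] exI[of _ 0]) auto
next
  case (snoc p u)
  have \<xi>: "snd (\<xi> 0) \<in> edges \<G>" "fst (\<xi> 0) \<in> \<Sigma> (snd (\<xi> 0))"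
    "rng \<G> (snd (\<xi> (Suc 0))) = src \<G> (snd (\<xi> 0))"
    using snoc.prems by (simp_all add: boundary_iff)
  show ?case
  proof (cases "no_backtrack p (\<xi> 0)")
    case True
    then have "walk x ((u @ [p]) @ [\<xi> 0]) (src \<G> (snd (\<xi> 0)))" "reduced_list ((u @ [p]) @ [\<xi> 0])"
      using \<xi> snoc.prems unfolding walk_snoc[of x "u @ [p]"] reduced_list_snoc[of "u @ [p]"]
      by (auto simp: inf_rng_def)
    then show ?thesis by (intro exI[of _ "(u @ [p]) @ [\<xi> 0]"] exI[of _ 0]) auto
  next
    case False
    then have "walk x u (inf_rng \<G> (suffix 1 \<xi>))" "reduced_list u"
      using \<xi> snoc.prems by (auto simp: no_backtrack_def inf_rng_def reduced_list_snoc)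
    from snoc.IH[OF boundary_suffix[OF snoc.prems(1)] this] show ?thesis by auto
  qed
qed

text \<open>With \<open>boundary_graft\<close> this gives an infinite path with range
  \<open>x\<close> that shares a tail with \<xi>.\<close>

lemma ex_walk_to_tail_from:
  assumes "\<xi> \<in> boundary \<G> \<Sigma>" "x \<in> verts \<G>"
  obtains w n y where "walk x w y" "reduced_list w" "w \<noteq> []" "snd (last w) = snd (\<xi> n)"
proof -
  have "inf_rng \<G> \<xi> \<in> verts \<G>" using assms by (simp add: inf_rng_def boundary_iff)
  then obtain u where "walk x u (inf_rng \<G> \<xi>)" "reduced_list u"
    using ex_reduced_walk[OF assms(2)] by blast
  from ex_walk_to_tail[OF assms(1) this] show ?thesis using that by blast
qed

subsection \<open>The action on the boundary\<close>

lemma body_cat_Nil [simp]: "body (cat \<G> w (Word y [] h)) = body w"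
  by (cases w) simp

text \<open>Makes \<open>boundary_act\<close> computable: the reduced form of the product arises by
  feeding the letters of \<xi>, one by one, to the normal form of \<open>w\<close>.\<close>

lemma body_reduced_form_segment:
  assumes w: "word_between x w y" and \<xi>: "\<xi> \<in> boundary \<G> \<Sigma>" "inf_rng \<G> \<xi> = y"
  shows "body (reduced_form \<G> \<Sigma> (fg_mult \<G> (fg_class \<G> w) (fg_class \<G> (segment \<G> \<xi> m)))) =
    body (foldl step (act (Word x [] 1\<^bsub>x\<^esub>) w) (prefix m \<xi>))"
proof -
  let ?z = "rng \<G> (snd (\<xi> m))" and ?x = "Word x [] 1\<^bsub>x\<^esub>"
  note walk = boundary_prefix(1)[OF \<xi>(1), of m, unfolded \<xi>(2)]
  have seg: "segment \<G> \<xi> m = Word y (prefix m \<xi>) 1\<^bsub>?z\<^esub>"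
    using boundary_prefix(3)[OF \<xi>(1)] \<xi>(2) by simp
  have q: "word_between y (segment \<G> \<xi> m) ?z" using walk walk_verts[OF walk] by (simp add: seg)
  have x: "reduced_between x ?x x" using w word_between_verts by simp
  have "reduced_form \<G> \<Sigma> (fg_mult \<G> (fg_class \<G> w) (fg_class \<G> (segment \<G> \<xi> m))) =
      act (act ?x w) (segment \<G> \<xi> m)"
    by (simp only: fg_mult_class[OF w q] reduced_form_class[OF word_between_cat[OF w q]]
        act_cat[OF x w q])
  then show ?thesis by (simp only: seg act_Word[OF walk] body_cat_Nil)
qed

text \<open>Once \<open>n\<close> letters of \<xi> are read, each further one adds one letter of
  \<eta>, so every position is eventually constant; eventual values determine the limit.\<close>

lemma boundary_act_eqI:
  assumes w: "word_between x w y" and \<xi>: "\<xi> \<in> boundary \<G> \<Sigma>" "inf_rng \<G> \<xi> = y"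
    and lim: "\<And>j. body (foldl step (act (Word x [] 1\<^bsub>x\<^esub>) w) (prefix (n + j) \<xi>)) = prefix (l + j) \<eta>"
  shows "boundary_act \<G> \<Sigma> (fg_class \<G> w) \<xi> = \<eta>"
proof -
  define b where "b m = body (foldl step (act (Word x [] 1\<^bsub>x\<^esub>) w) (prefix m \<xi>))" for m
  have \<eta>: "\<forall>\<^sub>F m in sequentially. i < length (b m) \<and> b m ! i = \<eta> i" for i
  proof (rule eventually_sequentiallyI[of "n + Suc i"])
    fix m assume "n + Suc i \<le> m"
    then have "b m = prefix (l + (m - n)) \<eta>" using lim[of "m - n"] by (simp add: b_def)
    then show "i < length (b m) \<and> b m ! i = \<eta> i" using \<open>n + Suc i \<le> m\<close> by simp
  qed
  have "\<zeta> = \<eta>" if \<zeta>: "\<And>i. \<forall>\<^sub>F m in sequentially. i < length (b m) \<and> b m ! i = \<zeta> i" for \<zeta>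
  proof
    fix i
    have "\<forall>\<^sub>F m in sequentially. \<zeta> i = \<eta> i" using \<zeta>[of i] \<eta>[of i] by eventually_elim simp
    then show "\<zeta> i = \<eta> i" by simp
  qed
  with \<eta> show ?thesis
    unfolding boundary_act_def Let_def body_reduced_form_segment[OF w \<xi>] b_def[symmetric]
    by (intro the_equality allI) blast+
qed

text \<open>Once a letter of \<open>\<xi>\<close> has been appended to the reduced word, the group element at its end lies
  in the image of the edge group, so it cannot make the next letter of \<open>\<xi>\<close> cancel.\<close>

definition absorbed :: "('v, 'e, 'g) Defs.word \<Rightarrow> 'e \<Rightarrow> bool" where
  "absorbed S e \<longleftrightarrow> (\<exists>x u s k. S = Word x (u @ [(s, e)]) (emb \<G> (opp \<G> e) k) \<and> k \<in> ecarrier e)"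

text \<open>If the letter \<open>(h, f)\<close> cancelled, \<open>e\<close> would be the reverse of
  \<open>f\<close>, and \<open>emb \<G> f k\<close> and its product with \<open>h\<close> would lie
  in the edge subgroup. Then so would \<open>h\<close>, which as an element of the transversal would
  be 1, against \<open>no_backtrack\<close>.\<close>

lemma step_absorbed:
  assumes S: "absorbed S e" and e: "e \<in> edges \<G>" and p: "snd p \<in> edges \<G>" "fst p \<in> \<Sigma> (snd p)"
    and adj: "rng \<G> (snd p) = src \<G> e" "no_backtrack (g, e) p"
  shows "absorbed (step S p) (snd p) \<and> (\<exists>s. body (step S p) = body S @ [(s, snd p)])"
proof -
  obtain h f where p_eq: "p = (h, f)" by fastforce
  obtain x u s k where S: "S = Word x (u @ [(s, e)]) (emb \<G> (opp \<G> e) k)" "k \<in> ecarrier e"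
    using S by (auto simp: absorbed_def)
  have f: "f \<in> edges \<G>" "h \<in> \<Sigma> f" "rng \<G> f = src \<G> e" using p p_eq adj by auto
  have k: "emb \<G> (opp \<G> e) k \<in> vcarrier (rng \<G> f)" using S f e by simp
  from f(1) k transversal_closed[OF f(1,2)] show ?thesis
  proof (cases rule: step_cases[where u = "u @ [(s, e)]" and x = x])
    case (cancel u' t l)
    have ef: "e = opp \<G> f" using cancel by simp
    interpret group "vgrp \<G> (rng \<G> f)" by (rule group_vgrp[OF rng_in[OF f(1)]])
    interpret H: subgroup "edge_subgroup \<G> f" "vgrp \<G> (rng \<G> f)" using f(1) by (rule edge_subgroup)
    have kl: "emb \<G> f k \<in> edge_subgroup \<G> f" "emb \<G> f l \<in> edge_subgroup \<G> f"
      using S cancel f(1) by (auto simp: edge_subgroup_def ef)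
    have eq: "emb \<G> f k \<cdot>\<^bsub>rng \<G> f\<^esub> h = emb \<G> f l" using cancel(3) f(1) by (simp add: ef)
    have hc: "h \<in> vcarrier (rng \<G> f)" by (rule transversal_closed[OF f(1,2)])
    have "h = inv\<^bsub>vgrp \<G> (rng \<G> f)\<^esub> emb \<G> f k \<cdot>\<^bsub>rng \<G> f\<^esub> emb \<G> f l"
      using inv_solve_left[OF hc H.mem_carrier[OF kl(1)] H.mem_carrier[OF kl(2)]] eq by simp
    then have "h \<in> edge_subgroup \<G> f" using kl by simp
    then obtain m where m: "m \<in> ecarrier f" "h = emb \<G> f m" by (auto simp: edge_subgroup_def)
    \<comment> \<open>One factorization comes from the transversal, the other from the edge
      subgroup; uniqueness identifies \<open>h\<close> with 1.\<close>
    have "decompose f h = (h, \<one>\<^bsub>egrp \<G> f\<^esub>)" "decompose f h = (1\<^bsub>rng \<G> f\<^esub>, m)"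
      by (rule decompose_eqI; use f(1,2) m hc in simp)+
    then have "h = 1\<^bsub>rng \<G> f\<^esub>" by simp
    then show ?thesis using adj(2) ef by (simp add: p_eq no_backtrack_def)
  next
    case (append t l)
    then show ?thesis using S f by (auto simp: p_eq absorbed_def)
  qed
qed

lemma prefix_Suc_Cons: "prefix (Suc n) \<xi> = \<xi> 0 # prefix n (suffix 1 \<xi>)"
  by (simp add: subsequence_def upt_conv_Cons suffix_def map_Suc_upt[symmetric] comp_def del: upt_Suc)

text \<open>Each cancellation shortens \<open>u\<close>, so after at most \<open>length u\<close> of
  them a letter is appended, and the result is absorbed.\<close>

lemma foldl_step_eventually_absorbed:
  assumes "\<xi> \<in> boundary \<G> \<Sigma>" "walk x u (inf_rng \<G> \<xi>)" "a \<in> vcarrier (inf_rng \<G> \<xi>)"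
  shows "\<exists>n. absorbed (foldl step (Word x u a) (prefix (Suc n) \<xi>)) (snd (\<xi> n))"
  using assms
proof (induction u arbitrary: \<xi> a rule: measure_induct_rule[of length])
  case (less u)
  obtain g f where p: "\<xi> 0 = (g, f)" by fastforce
  have f: "f \<in> edges \<G>" "g \<in> \<Sigma> f" "inf_rng \<G> \<xi> = rng \<G> f" "inf_rng \<G> (suffix 1 \<xi>) = src \<G> f"
    using less.prems(1) p unfolding boundary_iff inf_rng_def
    by (metis fst_conv snd_conv, metis fst_conv snd_conv, simp, metis One_nat_def plus_1_eq_Suc suffix_nth snd_conv)
  have a: "a \<in> vcarrier (rng \<G> f)" using less.prems f by simp
  from f(1) a transversal_closed[OF f(1,2)] show ?case
  proof (cases rule: step_cases[where u = u and x = x])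
    case (cancel u' h k)
    have h: "walk x u' (src \<G> f)" "h \<in> vcarrier (src \<G> f)"
      using less.prems(2) f(1) by (auto simp: cancel(1) f(3))
    have "\<exists>n. absorbed (foldl step (Word x u' (h \<cdot>\<^bsub>src \<G> f\<^esub> emb \<G> (opp \<G> f) k))
        (prefix (Suc n) (suffix 1 \<xi>))) (snd (suffix 1 \<xi> n))"
    proof (rule less.IH)
      show "length u' < length u" by (simp add: cancel(1))
      show "suffix 1 \<xi> \<in> boundary \<G> \<Sigma>" by (rule boundary_suffix[OF less.prems(1)])
      show "walk x u' (inf_rng \<G> (suffix 1 \<xi>))" unfolding f(4) by (rule h)
      show "h \<cdot>\<^bsub>src \<G> f\<^esub> emb \<G> (opp \<G> f) k \<in> vcarrier (inf_rng \<G> (suffix 1 \<xi>))"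
        unfolding f(4) using h(2) f(1) cancel(2) by simp
    qed
    then obtain n where n: "absorbed (foldl step (Word x u' (h \<cdot>\<^bsub>src \<G> f\<^esub> emb \<G> (opp \<G> f) k))
        (prefix (Suc n) (suffix 1 \<xi>))) (snd (suffix 1 \<xi> n))" ..
    show ?thesis using n
      by (intro exI[of _ "Suc n"])
        (simp only: prefix_Suc_Cons[where n = "Suc n"] foldl_Cons p cancel(4) suffix_nth plus_1_eq_Suc)
  next
    case (append s k)
    then have "absorbed (step (Word x u a) (\<xi> 0)) f" by (auto simp: absorbed_def p)
    then show ?thesis by (intro exI[of _ 0]) (simp add: p)
  qed
qed

text \<open>By \<open>step_absorbed\<close>, after the first appended letter all letters of \<xi>
  are appended, with group elements possibly changed but edges kept.\<close>

lemma boundary_act_tail: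
  assumes w: "word_between x w y" and \<xi>: "\<xi> \<in> boundary \<G> \<Sigma>" "inf_rng \<G> \<xi> = y"
  obtains n l where "\<And>j. snd (boundary_act \<G> \<Sigma> (fg_class \<G> w) \<xi> (l + j)) = snd (\<xi> (n + j))"
proof -
  let ?S = "\<lambda>m. foldl step (act (Word x [] 1\<^bsub>x\<^esub>) w) (prefix m \<xi>)"
  have "reduced_between x (act (Word x [] 1\<^bsub>x\<^esub>) w) y"
    using act_reduced_between(1)[OF _ w] w word_between_verts by simp
  then obtain u a where "act (Word x [] 1\<^bsub>x\<^esub>) w = Word x u a" "walk x u y" "a \<in> vcarrier y"
    by (rule reduced_betweenE)
  then obtain n where n: "absorbed (?S (Suc n)) (snd (\<xi> n))"
    using foldl_step_eventually_absorbed[OF \<xi>(1)] \<xi>(2) by metis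
  have B: "snd (\<xi> i) \<in> edges \<G>" "fst (\<xi> i) \<in> \<Sigma> (snd (\<xi> i))"
    "rng \<G> (snd (\<xi> (Suc i))) = src \<G> (snd (\<xi> i))" "no_backtrack (\<xi> i) (\<xi> (Suc i))" for i
    using \<xi>(1) by (simp_all add: boundary_iff)
  have step: "absorbed (?S (Suc (Suc m))) (snd (\<xi> (Suc m))) \<and>
      (\<exists>s. body (?S (Suc (Suc m))) = body (?S (Suc m)) @ [(s, snd (\<xi> (Suc m)))])"
    if "absorbed (?S (Suc m)) (snd (\<xi> m))" for m
  proof -
    have "?S (Suc (Suc m)) = step (?S (Suc m)) (\<xi> (Suc m))"
      unfolding subseq_to_Suc[of 0 "Suc m" \<xi>, OF le0] by simp
    then show ?thesis
      using step_absorbed[OF that B(1) B(1,2) B(3), of "fst (\<xi> m)"] B(4) by simp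
  qed
  have absorbed: "absorbed (?S (Suc (n + j))) (snd (\<xi> (n + j)))" for j
    by (induction j) (use n step in auto)
  have "\<exists>s. body (?S (Suc (Suc (n + j)))) = body (?S (Suc (n + j))) @ [(s, snd (\<xi> (Suc (n + j))))]" for j
    using step[OF absorbed] by blast
  then obtain s where s: "\<And>j. body (?S (Suc (Suc (n + j)))) =
      body (?S (Suc (n + j))) @ [(s j, snd (\<xi> (Suc (n + j))))]"
    by metis
  \<comment> \<open>The candidate limit: the body reached after \<open>Suc n\<close> letters,
    followed by the letters appended later. Position \<open>l\<close> of \<eta> thus matches letter
    \<open>Suc n\<close> of \<xi>.\<close>
  define \<eta> where "\<eta> = body (?S (Suc n)) \<frown> (\<lambda>j. (s j, snd (\<xi> (Suc (n + j)))))"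
  define l where "l = length (body (?S (Suc n)))"
  have "body (?S (Suc n + j)) = prefix (l + j) \<eta>" for j
  proof (induction j)
    case 0
    show ?case by (simp add: \<eta>_def l_def)
  next
    case (Suc j)
    have "body (?S (Suc n + Suc j)) = prefix (l + j) \<eta> @ [(s j, snd (\<xi> (Suc (n + j))))]"
      using s[of j] Suc by simp
    also have "\<dots> = prefix (l + Suc j) \<eta>" by (simp add: \<eta>_def l_def)
    finally show ?case .
  qed
  then have "boundary_act \<G> \<Sigma> (fg_class \<G> w) \<xi> = \<eta>" by (rule boundary_act_eqI[OF w \<xi>])
  then show ?thesis by (intro that[of l "Suc n"]) (simp add: \<eta>_def l_def)
qed

subsection \<open>Minimality and flowing\<close>

lemma word_rng_segment: "word_rng (segment \<G> \<xi> n) = inf_rng \<G> \<xi>"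
  by (simp add: segment_def)

lemma segment_eqI:
  assumes "inf_rng \<G> \<eta> = inf_rng \<G> \<xi>" "\<And>i. i < n \<Longrightarrow> \<eta> i = \<xi> i"
  shows "segment \<G> \<eta> n = segment \<G> \<xi> n"
  using assms by (cases n) (auto simp: segment_def)

lemma segment_eqD:
  assumes "segment \<G> \<eta> n = segment \<G> \<xi> n"
  shows "inf_rng \<G> \<eta> = inf_rng \<G> \<xi>" "i < n \<Longrightarrow> \<eta> i = \<xi> i"
  using assms by (auto simp: segment_def)

text \<open>The cylinders enter only as generators of the topology. The induction follows the
  generation of \<open>T\<close>; at an intersection the longer of the two initial segments
  serves.\<close>

lemma openin_boundary_at:
  assumes "openin (boundary_at \<G> \<Sigma> v) T" "\<xi> \<in> T"
  shows "\<exists>n. \<forall>\<eta>\<in>boundary \<G> \<Sigma>. inf_rng \<G> \<eta> = v \<longrightarrow> (\<forall>i<n. \<eta> i = \<xi> i) \<longrightarrow> \<eta> \<in> T"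
proof -
  have "generate_topology_on {cylinder \<G> \<Sigma> \<mu> | \<mu>. is_path \<G> \<Sigma> \<mu> \<and> word_rng \<mu> = v} T"
    using assms(1) by (simp add: boundary_at_def openin_topology_generated_by_iff)
  then show ?thesis using assms(2)
  proof induction
    case (Int S T)
    then obtain m n where
      m: "\<forall>\<eta>\<in>boundary \<G> \<Sigma>. inf_rng \<G> \<eta> = v \<longrightarrow> (\<forall>i<m. \<eta> i = \<xi> i) \<longrightarrow> \<eta> \<in> S" and
      n: "\<forall>\<eta>\<in>boundary \<G> \<Sigma>. inf_rng \<G> \<eta> = v \<longrightarrow> (\<forall>i<n. \<eta> i = \<xi> i) \<longrightarrow> \<eta> \<in> T"
      by auto
    show ?case
    proof (intro exI[of _ "max m n"] ballI impI IntI)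
      fix \<eta> assume \<eta>: "\<eta> \<in> boundary \<G> \<Sigma>" "inf_rng \<G> \<eta> = v" "\<forall>i<max m n. \<eta> i = \<xi> i"
      from m \<eta> show "\<eta> \<in> S" by simp
      from n \<eta> show "\<eta> \<in> T" by simp
    qed
  next
    case (UN K)
    then obtain S where "S \<in> K" "\<xi> \<in> S" by blast
    with UN.IH[OF this] show ?case by (meson UnionI)
  next
    case (Basis S)
    then obtain \<mu> where \<mu>: "S = cylinder \<G> \<Sigma> \<mu>" "word_rng \<mu> = v" by blast
    then have \<xi>: "segment \<G> \<xi> (length (body \<mu>)) = \<mu>"
      using Basis by (simp add: cylinder_def)
    then have "inf_rng \<G> \<xi> = v" using \<mu>(2) word_rng_segment by metis
    then show ?case
      using segment_eqI[of _ \<xi> "length (body \<mu>)"] \<xi>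
      by (intro exI[of _ "length (body \<mu>)"]) (simp add: \<mu>(1) cylinder_def)
  qed simp
qed

lemma cylinder_segment:
  "cylinder \<G> \<Sigma> (segment \<G> \<xi> n) =
    {\<eta> \<in> boundary \<G> \<Sigma>. inf_rng \<G> \<eta> = inf_rng \<G> \<xi> \<and> (\<forall>i<n. \<eta> i = \<xi> i)}"
proof -
  have "length (body (segment \<G> \<xi> n)) = n" by (simp add: segment_def)
  moreover have "segment \<G> \<eta> n = segment \<G> \<xi> n \<longleftrightarrow>
      inf_rng \<G> \<eta> = inf_rng \<G> \<xi> \<and> (\<forall>i<n. \<eta> i = \<xi> i)" for \<eta>
    using segment_eqI segment_eqD by blast
  ultimately show ?thesis by (simp add: cylinder_def)
qed

lemma openin_cylinder_segment:
  "\<xi> \<in> boundary \<G> \<Sigma> \<Longrightarrow>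
    openin (boundary_at \<G> \<Sigma> (inf_rng \<G> \<xi>)) (cylinder \<G> \<Sigma> (segment \<G> \<xi> n))"
  unfolding boundary_at_def
  by (rule topology_generated_by_Basis) (auto simp: boundary_def word_rng_segment)

lemma topspace_boundary_at:
  "topspace (boundary_at \<G> \<Sigma> v) = {\<xi> \<in> boundary \<G> \<Sigma>. inf_rng \<G> \<xi> = v}"
proof -
  have "inf_rng \<G> \<xi> = word_rng \<mu>" if "\<xi> \<in> cylinder \<G> \<Sigma> \<mu>" for \<xi> \<mu>
    using that word_rng_segment[of \<xi> "length (body \<mu>)"] by (simp add: cylinder_def)
  moreover have "\<xi> \<in> topspace (boundary_at \<G> \<Sigma> (inf_rng \<G> \<xi>))" if "\<xi> \<in> boundary \<G> \<Sigma>" for \<xi>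
    using openin_subset[OF openin_cylinder_segment[OF that, of 0]] that
    by (auto simp: cylinder_segment)
  ultimately show ?thesis by (auto simp: boundary_at_def cylinder_def)
qed

lemma cylinder_edge_path:
  assumes "e \<in> edges \<G>"
  shows "cylinder \<G> \<Sigma> (edge_path \<G> e) = {\<xi> \<in> boundary \<G> \<Sigma>. \<xi> 0 = (1\<^bsub>rng \<G> e\<^esub>, e)}"
  by (auto simp: cylinder_def edge_path_def segment_def inf_rng_def)

text \<open>Density at \<eta> can be tested on the cylinders of its initial segments, which form a
  neighbourhood base, and the elements of \<open>pi1 \<G> v\<close> are the classes of words from
  \<open>v\<close> to \<open>v\<close>.\<close>

lemma minimal_action_iff:
  "minimal_action (pi1 \<G> v) (boundary_at \<G> \<Sigma> v) (boundary_act \<G> \<Sigma>) \<longleftrightarrow>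
    (\<forall>\<xi>\<in>boundary \<G> \<Sigma>. \<forall>\<eta>\<in>boundary \<G> \<Sigma>. \<forall>n. inf_rng \<G> \<xi> = v \<longrightarrow> inf_rng \<G> \<eta> = v \<longrightarrow>
      (\<exists>w. word_between v w v \<and>
        boundary_act \<G> \<Sigma> (fg_class \<G> w) \<xi> \<in> cylinder \<G> \<Sigma> (segment \<G> \<eta> n)))"
    (is "?L \<longleftrightarrow> ?R")
proof
  have orbit: "\<zeta> \<in> orbit (pi1 \<G> v) (boundary_act \<G> \<Sigma>) \<xi> \<longleftrightarrow>
      (\<exists>w. word_between v w v \<and> \<zeta> = boundary_act \<G> \<Sigma> (fg_class \<G> w) \<xi>)" for \<zeta> \<xi>
    by (auto simp: orbit_def pi1_def word_between_def)
  show ?R if ?L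
  proof (intro ballI allI impI)
    fix \<xi> \<eta> n
    assume \<xi>: "\<xi> \<in> boundary \<G> \<Sigma>" "inf_rng \<G> \<xi> = v" and \<eta>: "\<eta> \<in> boundary \<G> \<Sigma>" "inf_rng \<G> \<eta> = v"
    have "\<eta> \<in> boundary_at \<G> \<Sigma> v closure_of orbit (pi1 \<G> v) (boundary_act \<G> \<Sigma>) \<xi>"
      using that \<xi> \<eta> by (simp add: minimal_action_def topspace_boundary_at)
    moreover have "openin (boundary_at \<G> \<Sigma> v) (cylinder \<G> \<Sigma> (segment \<G> \<eta> n))"
      using openin_cylinder_segment[OF \<eta>(1)] \<eta>(2) by simp
    moreover have "\<eta> \<in> cylinder \<G> \<Sigma> (segment \<G> \<eta> n)" using \<eta> by (simp add: cylinder_segment)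
    ultimately show "\<exists>w. word_between v w v \<and>
        boundary_act \<G> \<Sigma> (fg_class \<G> w) \<xi> \<in> cylinder \<G> \<Sigma> (segment \<G> \<eta> n)"
      unfolding in_closure_of orbit by blast
  qed
  show ?L if R: ?R
    unfolding minimal_action_def
  proof (intro ballI equalityI closure_of_subset_topspace subsetI)
    fix \<xi> \<eta>
    assume "\<xi> \<in> topspace (boundary_at \<G> \<Sigma> v)" and \<eta>: "\<eta> \<in> topspace (boundary_at \<G> \<Sigma> v)"
    then have *: "\<exists>w. word_between v w v \<and>
        boundary_act \<G> \<Sigma> (fg_class \<G> w) \<xi> \<in> cylinder \<G> \<Sigma> (segment \<G> \<eta> n)" for n
      using R unfolding topspace_boundary_at by blast
    show "\<eta> \<in> boundary_at \<G> \<Sigma> v closure_of orbit (pi1 \<G> v) (boundary_act \<G> \<Sigma>) \<xi>"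
      unfolding in_closure_of
    proof (intro conjI allI impI \<eta>; elim conjE)
      fix T assume "\<eta> \<in> T" "openin (boundary_at \<G> \<Sigma> v) T"
      then obtain n where n: "\<forall>\<zeta>\<in>boundary \<G> \<Sigma>. inf_rng \<G> \<zeta> = v \<longrightarrow> (\<forall>i<n. \<zeta> i = \<eta> i) \<longrightarrow> \<zeta> \<in> T"
        using openin_boundary_at by blast
      obtain w where w: "word_between v w v"
        "boundary_act \<G> \<Sigma> (fg_class \<G> w) \<xi> \<in> cylinder \<G> \<Sigma> (segment \<G> \<eta> n)"
        using * by blast
      then have "boundary_act \<G> \<Sigma> (fg_class \<G> w) \<xi> \<in> T"
        using n \<eta> by (auto simp: cylinder_segment topspace_boundary_at)
      then show "\<exists>\<zeta>. \<zeta> \<in> orbit (pi1 \<G> v) (boundary_act \<G> \<Sigma>) \<xi> \<and> \<zeta> \<in> T"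
        unfolding orbit using w(1) by blast
    qed
  qed
qed

text \<open>A path \<zeta> in the cylinder of \<open>edge_path \<G> e\<close> and the path \<xi> are
  both transported to \<open>v\<close>. By minimality some translate of the transported \<xi> runs
  into an edge of \<zeta>; continuing \<zeta> from there by this translate reaches edges of
  \<xi>.\<close>

lemma minimal_imp_flows_to:
  assumes minimal: "minimal_action (pi1 \<G> v) (boundary_at \<G> \<Sigma> v) (boundary_act \<G> \<Sigma>)"
    and "nonsingular \<G>" and v: "v \<in> verts \<G>" and \<xi>: "\<xi> \<in> boundary \<G> \<Sigma>" and e: "e \<in> edges \<G>"
  shows "flows_to \<G> \<Sigma> \<xi> e"
proof -
  obtain \<zeta> where \<zeta>: "\<zeta> \<in> boundary \<G> \<Sigma>" "\<zeta> 0 = (1\<^bsub>rng \<G> e\<^esub>, e)"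
    using ex_boundary_from_edge assms by blast
  obtain p m y where p: "walk v p y" "reduced_list p" "p \<noteq> []" "snd (last p) = snd (\<xi> m)"
    using ex_walk_to_tail_from[OF \<xi> v] .
  obtain q n z where q: "walk v q z" "reduced_list q" "q \<noteq> []" "snd (last q) = snd (\<zeta> n)"
    using ex_walk_to_tail_from[OF \<zeta>(1) v] .
  define \<xi>' where "\<xi>' = p \<frown> suffix (Suc m) \<xi>"
  define \<zeta>' where "\<zeta>' = q \<frown> suffix (Suc n) \<zeta>"
  have \<xi>': "\<xi>' \<in> boundary \<G> \<Sigma>" "inf_rng \<G> \<xi>' = v"
    using boundary_graft[OF p(1,2,3) \<xi> p(4)] by (simp_all add: \<xi>'_def)
  have \<zeta>': "\<zeta>' \<in> boundary \<G> \<Sigma>" "inf_rng \<G> \<zeta>' = v"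
    using boundary_graft[OF q(1,2,3) \<zeta>(1) q(4)] by (simp_all add: \<zeta>'_def)
  \<comment> \<open>Length \<open>length q\<close> forces the translate through the last edge of
    \<open>q\<close>, which is the edge of \<open>\<zeta> n\<close>.\<close>
  obtain w where w: "word_between v w v"
    "boundary_act \<G> \<Sigma> (fg_class \<G> w) \<xi>' \<in> cylinder \<G> \<Sigma> (segment \<G> \<zeta>' (length q))"
    using minimal \<xi>' \<zeta>' unfolding minimal_action_iff by blast
  define \<eta> where "\<eta> = boundary_act \<G> \<Sigma> (fg_class \<G> w) \<xi>'"
  have \<eta>: "\<eta> \<in> boundary \<G> \<Sigma>" "\<And>i. i < length q \<Longrightarrow> \<eta> i = q ! i"
    using w by (auto simp: \<eta>_def cylinder_segment \<zeta>'_def)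
  obtain a b where tail: "\<And>j. snd (\<eta> (b + j)) = snd (\<xi>' (a + j))"
    unfolding \<eta>_def by (rule boundary_act_tail[OF w(1) \<xi>']) blast
  \<comment> \<open>Large enough that index \<open>a + j\<close> lies behind \<open>p\<close> and
    index \<open>b + j\<close> behind \<open>q\<close>.\<close>
  define j where "j = length p + length q"
  define l where "l = length q - 1"
  have l: "Suc l = length q" "snd (\<eta> l) = snd (\<zeta> n)"
    using q \<eta>(2)[of l] by (simp_all add: l_def last_conv_nth)
  \<comment> \<open>Up to index \<open>n\<close> this is \<zeta>, so it starts with the letter of
    \<open>edge_path \<G> e\<close>; then comes what follows index \<open>l\<close> in
    \<eta>.\<close>
  let ?\<nu> = "prefix (Suc n) \<zeta> \<frown> suffix (Suc l) \<eta>"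
  have "?\<nu> \<in> boundary \<G> \<Sigma>"
    using boundary_graft[OF boundary_prefix(1,2)[OF \<zeta>(1), of "Suc n"] _ \<eta>(1), of l] l(2) by simp
  moreover have "?\<nu> 0 = (1\<^bsub>rng \<G> e\<^esub>, e)"
    using subsequence_nth[of 0 "Suc n" 0 \<zeta>] \<zeta>(2) by (simp add: conc_def nth_append)
  ultimately have \<nu>: "?\<nu> \<in> cylinder \<G> \<Sigma> (edge_path \<G> e)" by (simp add: cylinder_edge_path[OF e])
  define i where "i = Suc n + (b + j - length q)"
  have "snd (?\<nu> i) = snd (\<eta> (b + j))"
    using l(1) by (simp add: i_def j_def ac_simps del: subseq_to_Suc)
  also have "\<dots> = snd (\<xi> (Suc m + (a + j - length p)))"
    unfolding tail by (simp add: \<xi>'_def j_def)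
  finally have "edge_flows_to \<G> \<Sigma> (snd (\<xi> (Suc m + (a + j - length p)))) e"
    unfolding edge_flows_to_def using \<nu> by (intro bexI[of _ ?\<nu>] exI[of _ i]) (simp_all add: i_def)
  then show ?thesis unfolding flows_to_def lies_on_def by blast
qed

text \<open>The path \<eta> is followed into its edge of index \<open>n\<close>, a path witnessing
  the flow leads from there to an edge of \<xi>, and then \<xi> takes over. The resulting \<omega>
  lies in the cylinder, and the group element that exchanges the two initial segments carries \<xi>
  to \<omega>.\<close>

lemma flows_to_imp_minimal:
  assumes v: "v \<in> verts \<G>" and flow: "\<And>\<xi> e. \<xi> \<in> boundary \<G> \<Sigma> \<Longrightarrow> e \<in> edges \<G> \<Longrightarrow> flows_to \<G> \<Sigma> \<xi> e"
  shows "minimal_action (pi1 \<G> v) (boundary_at \<G> \<Sigma> v) (boundary_act \<G> \<Sigma>)"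
  unfolding minimal_action_iff
proof (intro ballI allI impI)
  fix \<xi> \<eta> n
  assume \<xi>: "\<xi> \<in> boundary \<G> \<Sigma>" "inf_rng \<G> \<xi> = v" and \<eta>: "\<eta> \<in> boundary \<G> \<Sigma>" "inf_rng \<G> \<eta> = v"
  define e where "e = snd (\<eta> n)"
  have e: "e \<in> edges \<G>" using \<eta>(1) by (simp add: e_def boundary_iff)
  from flow[OF \<xi>(1) e] obtain i \<zeta> k where \<zeta>: "\<zeta> \<in> boundary \<G> \<Sigma>" "\<zeta> 0 = (1\<^bsub>rng \<G> e\<^esub>, e)"
    and k: "1 \<le> k" "snd (\<zeta> k) = snd (\<xi> i)"
    unfolding flows_to_def lies_on_def edge_flows_to_def cylinder_edge_path[OF e] by auto metis
  \<comment> \<open>Letter \<open>n\<close> of \<eta> is kept; letter 0 of \<zeta>, which has the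
    same edge, is dropped.\<close>
  define \<theta> where "\<theta> = prefix (Suc n) \<eta> \<frown> suffix 1 \<zeta>"
  have \<theta>: "\<theta> \<in> boundary \<G> \<Sigma>" "inf_rng \<G> \<theta> = v"
    using boundary_graft[OF boundary_prefix(1,2)[OF \<eta>(1), of "Suc n"] _ \<zeta>(1), of 0] \<zeta>(2) \<eta>(2)
    by (simp_all add: \<theta>_def e_def)
  \<comment> \<open>Owing to this overlap, \<open>\<zeta> k\<close> stands at index
    \<open>n + k\<close> of \<theta>, as \<open>k\<close> is at least 1.\<close>
  define r where "r = n + k"
  have r: "snd (\<theta> r) = snd (\<xi> i)" using k by (simp add: \<theta>_def r_def del: subseq_to_Suc)
  let ?P = "prefix (Suc r) \<theta>" and ?y = "src \<G> (snd (\<xi> i))" and ?v = "Word v [] 1\<^bsub>v\<^esub>"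
  have R: "rng \<G> (snd (\<theta> (Suc r))) = ?y" "rng \<G> (snd (\<xi> (Suc i))) = ?y"
    using \<theta>(1) \<xi>(1) r by (simp_all add: boundary_iff)
  have P: "walk v ?P ?y" "reduced_list ?P"
    using boundary_prefix(1,2)[OF \<theta>(1), of "Suc r"] unfolding R \<theta>(2) by auto
  define \<omega> where "\<omega> = ?P \<frown> suffix (Suc i) \<xi>"
  have \<omega>: "\<omega> \<in> boundary \<G> \<Sigma>" "inf_rng \<G> \<omega> = v"
    using boundary_graft[OF P _ \<xi>(1), of i] r by (simp_all add: \<omega>_def)
  have y: "?y \<in> verts \<G>" using walk_verts[OF P(1)] ..
  let ?p = "Word v ?P 1\<^bsub>?y\<^esub>" and ?q = "Word v (prefix (Suc i) \<xi>) 1\<^bsub>?y\<^esub>"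
  have walk_q: "walk v (prefix (Suc i) \<xi>) ?y"
    using boundary_prefix(1)[OF \<xi>(1), of "Suc i"] unfolding R \<xi>(2) .
  have p: "word_between v ?p ?y" and q: "word_between v ?q ?y"
    using P walk_q y unfolding word_between_Word by auto
  obtain q' where q': "word_between ?y q' v" "fg_eq \<G> (cat \<G> q' ?q) (Word ?y [] 1\<^bsub>?y\<^esub>)"
    using ex_inverse_word[OF q] by blast
  \<comment> \<open>The product of \<open>?p\<close> and an inverse of \<open>?q\<close>, a loop at
    \<open>v\<close>.\<close>
  let ?w = "cat \<G> ?p q'"
  have w: "word_between v ?w v" by (rule word_between_cat[OF p q'(1)])
  have v': "reduced_between v ?v v" using v by simp
  have "fg_eq \<G> (cat \<G> ?w ?q) ?p"
    using fg_eq_cat_left[OF q'(2) p word_between_cat[OF q'(1) q]]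
    unfolding cat_assoc[OF p q'(1) q] cat_unit(1)[OF p] .
  then have "act ?v (cat \<G> ?w ?q) = act ?v ?p"
    by (rule act_respects_fg_eq[OF _ word_between_cat[OF w q] v'])
  also have "\<dots> = ?p" using P y by (intro act_reduced_between_unit[of _ _ ?y]) simp
  finally have "cat \<G> (foldl step (act ?v ?w) (prefix (Suc i) \<xi>)) (Word ?y [] 1\<^bsub>?y\<^esub>) = ?p"
    unfolding act_cat[OF v' w q] act_Word[OF walk_q] .
  moreover have "reduced_between v (foldl step (act ?v ?w) (prefix (Suc i) \<xi>)) ?y"
    using foldl_step[OF act_reduced_between(1)[OF v' w] walk_q] ..
  \<comment> \<open>Reading \<open>Suc i\<close> letters of \<xi> after \<open>?w\<close> leads to
    the same reduced word as reading \<open>?P\<close> from the trivial word. From here on both read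
    the same letters, and along the reduced path \<omega> nothing cancels.\<close>
  ultimately have fold_q: "foldl step (act ?v ?w) (prefix (Suc i) \<xi>) = ?p"
    using cat_unit(1)[OF reduced_between_imp_word_between] by simp
  have "boundary_act \<G> \<Sigma> (fg_class \<G> ?w) \<xi> = \<omega>"
  proof (rule boundary_act_eqI[OF w \<xi>])
    fix j
    have "prefix (Suc r + j) \<omega> = ?P @ prefix j (suffix (Suc i) \<xi>)"
      unfolding \<omega>_def by (subst prefix_conc_snd) (simp_all del: subseq_to_Suc)
    moreover have "foldl step ?v (prefix (Suc r + j) \<omega>) = Word v (prefix (Suc r + j) \<omega>) 1\<^bsub>rng \<G> (snd (\<omega> (Suc r + j)))\<^esub>"
      using boundary_prefix(1,2)[OF \<omega>(1), of "Suc r + j"] \<omega>(2) by (intro foldl_step_reduced) simp_all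
    moreover have "foldl step ?v ?P = ?p" by (rule foldl_step_reduced[OF P])
    moreover have "prefix (Suc i + j) \<xi> = prefix (Suc i) \<xi> @ prefix j (suffix (Suc i) \<xi>)"
      by (simp only: subsequence_append subsequence_shift add_0_right)
    ultimately have "foldl step (act ?v ?w) (prefix (Suc i + j) \<xi>) =
        Word v (prefix (Suc r + j) \<omega>) 1\<^bsub>rng \<G> (snd (\<omega> (Suc r + j)))\<^esub>"
      using fold_q by (simp only: foldl_append)
    then show "body (foldl step (act ?v ?w) (prefix (Suc i + j) \<xi>)) = prefix (Suc r + j) \<omega>"
      by (simp only: word.sel)
  qed
  moreover have "\<omega> \<in> cylinder \<G> \<Sigma> (segment \<G> \<eta> n)"
    using \<omega> \<eta>(2) by (auto simp: cylinder_segment \<omega>_def \<theta>_def r_def nth_append simp del: subseq_to_Suc)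
  ultimately show "\<exists>w. word_between v w v \<and>
      boundary_act \<G> \<Sigma> (fg_class \<G> w) \<xi> \<in> cylinder \<G> \<Sigma> (segment \<G> \<eta> n)"
    using w by metis
qed

end

theorem theorem5p5:
  fixes \<G> :: "('v, 'e, 'g, 'h) graph_of_groups"
    and \<Sigma> :: "'e \<Rightarrow> 'g set"
    and v :: 'v
  assumes "graph_of_groups \<G>"
    and "transversals \<G> \<Sigma>"
    and "locally_finite \<G>"
    and "nonsingular \<G>"
    and "countable_groups \<G>"
    and "edges \<G> \<noteq> {}"
    and "v \<in> verts \<G>"
  shows "minimal_action (pi1 \<G> v) (boundary_at \<G> \<Sigma> v) (boundary_act \<G> \<Sigma>) \<longleftrightarrow>
         (\<forall>\<xi>\<in>boundary \<G> \<Sigma>. \<forall>e\<in>edges \<G>. flows_to \<G> \<Sigma> \<xi> e)"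
proof -
  interpret transversal_graph_of_groups \<G> \<Sigma>
    using assms(1,2) by (simp add: transversal_graph_of_groups_def transversal_graph_of_groups_axioms_def)
  show ?thesis
    using minimal_imp_flows_to flows_to_imp_minimal assms(4,7) by blast
qed

end
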